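(* Let $\lambda$ be a partition, let $\sigma$ be a non-attacking and top-row increasing positive filling of $\mathsf{dg}'(\lambda)$, and let $\eta\in\mathcal A^+$. Then there is a bijection $\varphi:[\sigma]\to[\sigma]$ such that for all $\tau\in[\sigma]$, $$(\mathsf{maj},\eta^\circ)(\varphi(\tau))=(\mathsf{maj},\overline{\mathsf{quadcoinv}})(\tau)\quad\text{and}\quad c_\tau(q,t)=c_{\varphi(\tau)}(q,t).$$
   Context: $\mathsf{dg}'(\lambda)$ has boxes $(i,j)$, $1\le j\le\ell(\lambda)$, $1\le i\le\lambda_j$ (row $i$ from the bottom; column $j$ has height $\lambda_j$). $\mathsf{South}(u)$ is the box directly below $u$; $\mathsf{leg}(u)$ is the number of boxes strictly above $u$ in its column. A rectangle is a maximal set of consecutive columns of equal height; its top row is the row whose index equals that height. $n(\lambda)=\sum_i(i-1)\lambda_i$. Two fillings are row-equivalent if each row has the same multiset of entries; $[\sigma]$ is the row-equivalence class of $\sigma$. For a positive filling $\sigma$, $\hat\sigma$ adds entry $0$ at $(\lambda_j+1,j)$ and $\infty$ at $(0,j)$ for each column $j$; values ordered naturally. $I(a,b)=1$ if $a>b$, else $0$; $\mathcal Q(a,b,c)=1$ iff exactly one of $I(a,b)=1$, $I(c,b)=0$, $I(a,c)=0$. $\mathsf{maj}(\sigma)=\sum(\mathsf{leg}(z)+1)$ over $z$ not in row 1 with $\sigma(z)>\sigma(\mathsf{South}(z))$. Queue inversion triple: $(a,b,c)$ with $a$ at $(r+1,j)$, $b$ at $(r,j)$, $c$ at $(r,k)$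 of $\hat\sigma$, $k>j$, $c\ne0$, $\mathcal Q(a,b,c)=1$. A quadruple position: $z$ at $(r+1,j)$, $w$ at $(r+1,k)$, $u$ at $(r,j)$, $v$ at $(r,k)$ of $\hat\sigma$ with $j<k$, $\lambda_j=\lambda_k$, $0\le r\le\lambda_j$. Quadcoinv: $\mathcal Q(z,w,u,v)=1$ if $w=v$ and $z,u,w$ pairwise distinct; $=0$ if $w=u$, $z\ne w$, $v\ne w$; otherwise $=\mathcal Q(z,u,v)$. $\mathsf{quadcoinv}(\sigma)$ = number of quadruple positions with $\mathcal Q(z,w,u,v)=1$ plus number of queue inversion triples whose column of $a,b$ is strictly taller than the column of $c$; $\overline{\mathsf{quadcoinv}}=n(\lambda)-\mathsf{quadcoinv}$. The statistics $\eta$: let $\mathcal S^*$ be the orderings $(z=w>v>u)$, $(u\ge z=w>v)$, $(v>u\ge z=w)$; $X_1: z>w>v>u$; $X_2: z>w>u>v$; $Y_1: u>v\ge z>w$; $Y_2: v>u\ge z>w$; $Z_1$: $\{z>u>v\ge w,\ v\ge z>w>u\}$; $Z_2$: $\{z>v>u\ge w,\ u\ge z>w>v\}$. $\mathcal S_1,\dots,\mathcal S_8$ consist of $\mathcal S^*$, the orderings $z>v\ge w>u$ and $u\ge z>v\ge w$, and respectively $(X_1,Y_1,Z_1)$, $(X_1,Y_2,Z_1)$, $(X_2,Y_1,Z_1)$, $(X_2,Y_2,Z_1)$, $(X_1,Y_1,Z_2)$, $(X_2,Y_1,Z_2)$, $(X_1,Y_2,Z_2)$, $(X_2,Y_2,Z_2)$.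 $\mathcal Q_{\mathcal S}(z,w,u,v)=1$ if $(z,w,u,v)$ satisfies an ordering of $\mathcal S^*$, or one of the other orderings of $\mathcal S$, or $(w,z,v,u)$ substituted for $(z,w,u,v)$ satisfies one of the other orderings of $\mathcal S$; else $0$. $\eta_{\mathcal S}(\sigma)$ = number of quadruple positions with $\mathcal Q_{\mathcal S}=1$ plus number of queue inversion triples whose column of $a,b$ is strictly taller than that of $c$; $\mathcal A^+=\{\eta_{\mathcal S_1},\dots,\eta_{\mathcal S_8}\}$. $\alpha(\sigma)$ = number of quadruple positions with $r\ge1$, $\mathcal Q_{\mathcal S}=0$ and $z,w,u,v$ not pairwise distinct; $\eta^\circ=n(\lambda)-\eta-\alpha$. Non-attacking: no distinct boxes $u,v$ with $\sigma(u)=\sigma(v)$ such that (I) same row; (II) $u=(i+1,j)$, $v=(i,k)$, $k>j$; (III) $u=(i,j)$, $v=(i-1,k)$, $k<j$, $\lambda_j=\lambda_k$. Top-row increasing: the top-row entries of each rectangle weakly increase left to right. A box is restricted if not in row 1 and $\sigma(u)=\sigma(\mathsf{South}(u))$, unrestricted otherwise. For $u=(i,j)$, $\overline{\mathsf{arm}}(u)=|\{(i-1,k):k>j,\ \lambda_k<\lambda_j\}|+|\{(i,k):k<j,\ \lambda_k=\lambda_j,\ (i,k)\text{ unrestricted}\}|$; $c_\sigma(q,t)=\prod\frac{1-t}{1-q^{\mathsf{leg}(u)+1}t^{\overline{\mathsf{arm}}(u)+1}}$ over $u$ not in row 1 with $\sigma(u)\ne\sigma(\mathsf{South}(u))$.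
   Formalization: Here [σ] is taken to be the set of non-attacking, top-row increasing positive fillings row-equivalent to σ; over all row-equivalent fillings the claim fails, e.g. λ=(1,1) with row entries 1, 2. *)

theory Defs
  imports
    "HOL-Library.FuncSet"
    "HOL-Library.Multiset"
    "HOL-Library.Extended_Nat"
    "HOL-Computational_Algebra.Computational_Algebra"
begin

section \<open>Diagrams\<close>

text \<open>
  A partition is the list of its positive parts; columns are numbered from 1, so
  column \<open>j\<close> has height \<open>lam ! (j - 1)\<close>.  A box is a pair \<open>(i, j)\<close> of a row (counted from
  the bottom, starting at 1) and a column.
\<close>

type_synonym box = "nat \<times> nat"
type_synonym filling = "box \<Rightarrow> nat"

definition is_partition :: "nat list \<Rightarrow> bool" where
  "is_partition lam \<longleftrightarrow> sorted_wrt (\<ge>) lam \<and> (\<forall>p\<in>set lam. 0 < p)"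

definition ht :: "nat list \<Rightarrow> nat \<Rightarrow> nat" where
  "ht lam j = lam ! (j - 1)"

definition dg :: "nat list \<Rightarrow> box set" where
  "dg lam = {(i, j). 1 \<le> j \<and> j \<le> length lam \<and> 1 \<le> i \<and> i \<le> ht lam j}"

definition south :: "box \<Rightarrow> box" where
  "south u = (fst u - 1, snd u)"

definition leg :: "nat list \<Rightarrow> box \<Rightarrow> nat" where
  "leg lam u = card {i. fst u < i \<and> (i, snd u) \<in> dg lam}"

definition n_stat :: "nat list \<Rightarrow> nat" where
  "n_stat lam = (\<Sum>i=1..length lam. (i - 1) * ht lam i)"

definition rectangle :: "nat list \<Rightarrow> nat \<Rightarrow> nat \<Rightarrow> bool" where
  "rectangle lam a b \<longleftrightarrow>
     1 \<le> a \<and> a \<le> b \<and> b \<le> length lam \<and> (\<forall>j\<in>{a..b}. ht lam j = ht lam a) \<and>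
     (a = 1 \<or> ht lam (a - 1) \<noteq> ht lam a) \<and>
     (b = length lam \<or> ht lam (b + 1) \<noteq> ht lam b)"

section \<open>Fillings\<close>

text \<open>Fillings are extensional: they carry no information outside the diagram.\<close>

definition positive_fillings :: "nat list \<Rightarrow> filling set" where
  "positive_fillings lam = dg lam \<rightarrow>\<^sub>E {0<..}"

definition row_content :: "nat list \<Rightarrow> filling \<Rightarrow> nat \<Rightarrow> nat multiset" where
  "row_content lam \<sigma> i = image_mset \<sigma> (mset_set {u \<in> dg lam. fst u = i})"

definition row_equivalent :: "nat list \<Rightarrow> filling \<Rightarrow> filling \<Rightarrow> bool" where
  "row_equivalent lam \<sigma> \<tau> \<longleftrightarrow> (\<forall>i. row_content lam \<sigma> i = row_content lam \<tau> i)"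

definition attacking :: "nat list \<Rightarrow> box \<Rightarrow> box \<Rightarrow> bool" where
  "attacking lam u v \<longleftrightarrow> u \<noteq> v \<and>
     (fst u = fst v
      \<or> fst u = fst v + 1 \<and> snd v > snd u
      \<or> fst u = fst v + 1 \<and> snd v < snd u \<and> ht lam (snd u) = ht lam (snd v))"

definition non_attacking :: "nat list \<Rightarrow> filling \<Rightarrow> bool" where
  "non_attacking lam \<sigma> \<longleftrightarrow>
     \<not> (\<exists>u\<in>dg lam. \<exists>v\<in>dg lam. attacking lam u v \<and> \<sigma> u = \<sigma> v)"

definition top_row_increasing :: "nat list \<Rightarrow> filling \<Rightarrow> bool" where
  "top_row_increasing lam \<sigma> \<longleftrightarrow>
     (\<forall>a b. rectangle lam a b \<longrightarrow> mono_on {a..b} (\<lambda>j. \<sigma> (ht lam a, j)))"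

text \<open>
  The class of \<open>\<sigma>\<close> is taken inside the set of non-attacking, top-row increasing positive
  fillings.  Among all positive fillings the statistics below are not equidistributed over a
  row-equivalence class: for \<open>lam = [1, 1]\<close> and row content \<open>{1, 2}\<close>, the values of
  \<open>quadcoinv_bar\<close> are 0 and 1, those of \<open>eta_circ\<close> are 0 and 0.
\<close>

definition row_class :: "nat list \<Rightarrow> filling \<Rightarrow> filling set" where
  "row_class lam \<sigma> =
     {\<tau> \<in> positive_fillings lam. non_attacking lam \<tau> \<and> top_row_increasing lam \<tau> \<and>
        row_equivalent lam \<sigma> \<tau>}"

text \<open>The augmented filling; \<open>aug lam \<sigma> i j\<close> is meaningful for \<open>i \<le> ht lam j + 1\<close>.\<close>

definition aug :: "nat list \<Rightarrow> filling \<Rightarrow> nat \<Rightarrow> nat \<Rightarrow> enat" where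
  "aug lam \<sigma> i j = (if i = 0 then \<infinity> else if i = ht lam j + 1 then 0 else enat (\<sigma> (i, j)))"

section \<open>The statistics maj and quadcoinv\<close>

definition maj :: "nat list \<Rightarrow> filling \<Rightarrow> nat" where
  "maj lam \<sigma> = (\<Sum>z | z \<in> dg lam \<and> fst z \<noteq> 1 \<and> \<sigma> z > \<sigma> (south z). leg lam z + 1)"

definition I_ind :: "enat \<Rightarrow> enat \<Rightarrow> nat" where
  "I_ind a b = (if a > b then 1 else 0)"

definition Q3 :: "enat \<Rightarrow> enat \<Rightarrow> enat \<Rightarrow> nat" where
  "Q3 a b c =
     (if of_bool (I_ind a b = 1) + of_bool (I_ind c b = 0) + of_bool (I_ind a c = 0) = (1::nat)
      then 1 else 0)"

text \<open>
  \<open>(r, j, k)\<close> encodes the triple with entries \<open>a\<close>, \<open>b\<close>, \<open>c\<close> at \<open>(r + 1, j)\<close>, \<open>(r, j)\<close>, \<open>(r, k)\<close>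
  of the augmented filling.
\<close>

definition queue_inversion_triples :: "nat list \<Rightarrow> filling \<Rightarrow> (nat \<times> nat \<times> nat) set" where
  "queue_inversion_triples lam \<sigma> =
     {(r, j, k). 1 \<le> j \<and> j < k \<and> k \<le> length lam \<and> r \<le> ht lam j \<and> r \<le> ht lam k + 1 \<and>
        aug lam \<sigma> r k \<noteq> 0 \<and>
        Q3 (aug lam \<sigma> (r + 1) j) (aug lam \<sigma> r j) (aug lam \<sigma> r k) = 1}"

definition uneven_triples :: "nat list \<Rightarrow> filling \<Rightarrow> nat" where
  "uneven_triples lam \<sigma> =
     card {(r, j, k). (r, j, k) \<in> queue_inversion_triples lam \<sigma> \<and> ht lam j > ht lam k}"

definition Q4 :: "enat \<Rightarrow> enat \<Rightarrow> enat \<Rightarrow> enat \<Rightarrow> nat" where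
  "Q4 z w u v =
     (if w = v \<and> distinct [z, u, w] then 1
      else if w = u \<and> z \<noteq> w \<and> v \<noteq> w then 0
      else Q3 z u v)"

text \<open>
  \<open>(r, j, k)\<close> encodes the quadruple with entries \<open>z\<close>, \<open>w\<close>, \<open>u\<close>, \<open>v\<close> at \<open>(r + 1, j)\<close>,
  \<open>(r + 1, k)\<close>, \<open>(r, j)\<close>, \<open>(r, k)\<close> of the augmented filling.
\<close>

definition quad_positions :: "nat list \<Rightarrow> (nat \<times> nat \<times> nat) set" where
  "quad_positions lam =
     {(r, j, k). 1 \<le> j \<and> j < k \<and> k \<le> length lam \<and> ht lam j = ht lam k \<and> r \<le> ht lam j}"

definition at_quad ::
  "nat list \<Rightarrow> filling \<Rightarrow> (enat \<Rightarrow> enat \<Rightarrow> enat \<Rightarrow> enat \<Rightarrow> 'b) \<Rightarrow> nat \<times> nat \<times> nat \<Rightarrow> 'b" where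
  "at_quad lam \<sigma> f p = (case p of (r, j, k) \<Rightarrow>
     f (aug lam \<sigma> (r + 1) j) (aug lam \<sigma> (r + 1) k) (aug lam \<sigma> r j) (aug lam \<sigma> r k))"

definition quadcoinv :: "nat list \<Rightarrow> filling \<Rightarrow> nat" where
  "quadcoinv lam \<sigma> =
     card {p \<in> quad_positions lam. at_quad lam \<sigma> Q4 p = 1} + uneven_triples lam \<sigma>"

definition quadcoinv_bar :: "nat list \<Rightarrow> filling \<Rightarrow> int" where
  "quadcoinv_bar lam \<sigma> = int (n_stat lam) - int (quadcoinv lam \<sigma>)"

section \<open>The statistics eta\<close>

text \<open>An ordering is a predicate on \<open>(z, w, u, v)\<close>.\<close>

type_synonym ordering4 = "enat \<Rightarrow> enat \<Rightarrow> enat \<Rightarrow> enat \<Rightarrow> bool"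

definition S_star :: "ordering4 set" where
  "S_star = {\<lambda>z w u v. z = w \<and> w > v \<and> v > u,
             \<lambda>z w u v. u \<ge> z \<and> z = w \<and> w > v,
             \<lambda>z w u v. v > u \<and> u \<ge> z \<and> z = w}"

definition S_common :: "ordering4 set" where
  "S_common = {\<lambda>z w u v. z > v \<and> v \<ge> w \<and> w > u,
               \<lambda>z w u v. u \<ge> z \<and> z > v \<and> v \<ge> w}"

definition X1 :: "ordering4 set" where
  "X1 = {\<lambda>z w u v. z > w \<and> w > v \<and> v > u}"

definition X2 :: "ordering4 set" where
  "X2 = {\<lambda>z w u v. z > w \<and> w > u \<and> u > v}"

definition Y1 :: "ordering4 set" where
  "Y1 = {\<lambda>z w u v. u > v \<and> v \<ge> z \<and> z > w}"

definition Y2 :: "ordering4 set" where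
  "Y2 = {\<lambda>z w u v. v > u \<and> u \<ge> z \<and> z > w}"

definition Z1 :: "ordering4 set" where
  "Z1 = {\<lambda>z w u v. z > u \<and> u > v \<and> v \<ge> w,
         \<lambda>z w u v. v \<ge> z \<and> z > w \<and> w > u}"

definition Z2 :: "ordering4 set" where
  "Z2 = {\<lambda>z w u v. z > v \<and> v > u \<and> u \<ge> w,
         \<lambda>z w u v. u \<ge> z \<and> z > w \<and> w > v}"

text \<open>The eight systems, in the order \<open>S_1, \<dots>, S_8\<close>.\<close>

definition ordering_systems :: "ordering4 set set" where
  "ordering_systems =
     {S_star \<union> S_common \<union> X1 \<union> Y1 \<union> Z1,
      S_star \<union> S_common \<union> X1 \<union> Y2 \<union> Z1,
      S_star \<union> S_common \<union> X2 \<union> Y1 \<union> Z1,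
      S_star \<union> S_common \<union> X2 \<union> Y2 \<union> Z1,
      S_star \<union> S_common \<union> X1 \<union> Y1 \<union> Z2,
      S_star \<union> S_common \<union> X2 \<union> Y1 \<union> Z2,
      S_star \<union> S_common \<union> X1 \<union> Y2 \<union> Z2,
      S_star \<union> S_common \<union> X2 \<union> Y2 \<union> Z2}"

text \<open>
  No ordering outside \<open>S_star\<close> equals one in \<open>S_star\<close> as a predicate (the former force
  \<open>z > w\<close>, the latter \<open>z = w\<close>, and all are satisfiable), so \<open>S - S_star\<close> is the set of the
  other orderings of \<open>S\<close>.
\<close>

definition Q_sys :: "ordering4 set \<Rightarrow> enat \<Rightarrow> enat \<Rightarrow> enat \<Rightarrow> enat \<Rightarrow> nat" where
  "Q_sys S z w u v =
     (if (\<exists>P\<in>S_star. P z w u v) \<or> (\<exists>P\<in>S - S_star. P z w u v) \<or> (\<exists>P\<in>S - S_star. P w z v u)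
      then 1 else 0)"

definition eta :: "ordering4 set \<Rightarrow> nat list \<Rightarrow> filling \<Rightarrow> nat" where
  "eta S lam \<sigma> =
     card {p \<in> quad_positions lam. at_quad lam \<sigma> (Q_sys S) p = 1} + uneven_triples lam \<sigma>"

definition alpha :: "ordering4 set \<Rightarrow> nat list \<Rightarrow> filling \<Rightarrow> nat" where
  "alpha S lam \<sigma> =
     card {p \<in> quad_positions lam. fst p \<ge> 1 \<and> at_quad lam \<sigma> (Q_sys S) p = 0 \<and>
        \<not> at_quad lam \<sigma> (\<lambda>z w u v. distinct [z, w, u, v]) p}"

definition eta_circ :: "ordering4 set \<Rightarrow> nat list \<Rightarrow> filling \<Rightarrow> int" where
  "eta_circ S lam \<sigma> = int (n_stat lam) - int (eta S lam \<sigma>) - int (alpha S lam \<sigma>)"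

section \<open>The coefficient c\<close>

definition restricted :: "filling \<Rightarrow> box \<Rightarrow> bool" where
  "restricted \<sigma> u \<longleftrightarrow> fst u \<noteq> 1 \<and> \<sigma> u = \<sigma> (south u)"

definition arm_bar :: "nat list \<Rightarrow> filling \<Rightarrow> box \<Rightarrow> nat" where
  "arm_bar lam \<sigma> u = (case u of (i, j) \<Rightarrow>
     card {k. (i - 1, k) \<in> dg lam \<and> k > j \<and> ht lam k < ht lam j} +
     card {k. (i, k) \<in> dg lam \<and> k < j \<and> ht lam k = ht lam j \<and> \<not> restricted \<sigma> (i, k)})"

text \<open>The field \<open>\<rat>(q, t)\<close>, as the fraction field of \<open>\<rat>[q][t]\<close>.\<close>

type_synonym qt_field = "rat poly poly fract"

definition q_var :: qt_field where
  "q_var = Fract [:[:0, 1:]:] 1"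

definition t_var :: qt_field where
  "t_var = Fract [:0, 1:] 1"

definition c_coeff :: "nat list \<Rightarrow> filling \<Rightarrow> qt_field" where
  "c_coeff lam \<sigma> =
     (\<Prod>u | u \<in> dg lam \<and> fst u \<noteq> 1 \<and> \<sigma> u \<noteq> \<sigma> (south u).
        (1 - t_var) / (1 - q_var ^ (leg lam u + 1) * t_var ^ (arm_bar lam \<sigma> u + 1)))"

end

theory Submission
  imports Defs "HOL-Combinatorics.Transposition"
begin

text \<open>
  In a non-attacking filling a pair of vertically adjacent rows of a rectangle consists of columns
  carrying the same entry twice and of columns whose entries are otherwise pairwise distinct.  A
  quadruple meeting a column of the first kind counts for both statistics, so only the remaining
  columns matter; there \<open>\<Q>(z, u, v) = [v < z] - [v < u] + [z \<le> u]\<close>.  Additivity of this formula has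
  two consequences.  The triples between columns of different heights, like \<open>maj\<close> and \<open>c\<close>, depend
  only on the entries and on the number of descents of each row of each rectangle.  And exchanging
  two neighbouring columns in the order in which pairs are compared is compensated by exchanging
  their lower entries whenever this keeps the number of descents; hence the joint distribution
  of descents and \<open>quadcoinv\<close>, for a fixed upper row, does not depend on the order of the columns.

  Ordering the columns by increasing (decreasing) upper entry turns \<open>quadcoinv\<close> into a statistic with
  the choices \<open>X2\<close>, \<open>Y1\<close>, \<open>Z1\<close> (respectively \<open>X1\<close>, \<open>Y2\<close>, \<open>Z2\<close>).  The \<open>X\<close> part compares two descending
  columns, the \<open>Y\<close> part two ascending ones, and the mixed \<open>Z\<close> part only depends on the sets of
  entries of the two kinds of columns; so the order can be reversed in the \<open>X\<close> and \<open>Y\<close> parts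
  separately, which reaches all eight systems.

  The bijections for the pairs of rows are applied from the bottom up, moving everything below along
  with the lower row: the \<open>\<eta>\<close> statistics are invariant under permutations of columns.
\<close>

section \<open>Sums over pairs in a list\<close>

fun psum :: "('a \<Rightarrow> 'a \<Rightarrow> int) \<Rightarrow> 'a list \<Rightarrow> int" where
  "psum f [] = 0"
| "psum f (x # xs) = (\<Sum>y\<leftarrow>xs. f x y) + psum f xs"

lemma psum_cong_wrt:
  assumes "sorted_wrt R xs"
    and "\<And>x y. x \<in> set xs \<Longrightarrow> y \<in> set xs \<Longrightarrow> R x y \<Longrightarrow> f x y = g x y"
  shows "psum f xs = psum g xs"
  using assms
proof (induction xs)
  case (Cons x xs)
  have "(\<Sum>y\<leftarrow>xs. f x y) = (\<Sum>y\<leftarrow>xs. g x y)"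
    using Cons.prems by (intro arg_cong[of _ _ sum_list] map_cong) auto
  then show ?case
    using Cons by simp
qed simp

lemma psum_cong:
  assumes "distinct xs"
    and "\<And>x y. x \<in> set xs \<Longrightarrow> y \<in> set xs \<Longrightarrow> x \<noteq> y \<Longrightarrow> f x y = g x y"
  shows "psum f xs = psum g xs"
proof (rule psum_cong_wrt)
  show "sorted_wrt (\<noteq>) xs"
    using assms(1) by (induction xs) auto
qed (use assms in auto)

lemma psum_add: "psum (\<lambda>x y. f x y + g x y) xs = psum f xs + psum g xs"
  by (induction xs) (simp_all add: sum_list_addf)

lemma psum_append:
  "psum f (xs @ ys) = psum f xs + psum f ys + (\<Sum>x\<leftarrow>xs. \<Sum>y\<leftarrow>ys. f x y)"
  by (induction xs) simp_all

lemma psum_rev: "psum f (rev xs) = psum (\<lambda>x y. f y x) xs"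
proof (induction xs)
  case (Cons x xs)
  have "(\<Sum>y\<leftarrow>rev xs. f y x) = (\<Sum>y\<leftarrow>xs. f y x)"
    by (metis rev_map sum_list_rev)
  then show ?case
    using Cons by (simp add: psum_append)
qed simp

lemma psum_map: "psum f (map g xs) = psum (\<lambda>x y. f (g x) (g y)) xs"
  by (induction xs) (simp_all add: comp_def)

text \<open>Each unordered pair occurs once in the list and twice on the right, hence the factor 2.
  The right-hand side sees only the set of entries, which is what \<open>psum_perm\<close>
  exploits.\<close>

lemma psum_symmetric:
  assumes "distinct xs"
    and "\<And>x y. x \<in> set xs \<Longrightarrow> y \<in> set xs \<Longrightarrow> x \<noteq> y \<Longrightarrow> f x y = f y x"
  shows "2 * psum f xs = (\<Sum>x\<in>set xs. \<Sum>y\<in>set xs - {x}. f x y)"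
  using assms
proof (induction xs)
  case (Cons x xs)
  have x: "x \<notin> set xs"
    using Cons.prems by simp
  have split: "(\<Sum>y\<in>insert x (set xs) - {z}. f z y) = f z x + (\<Sum>y\<in>set xs - {z}. f z y)"
    if "z \<in> set xs" for z
  proof -
    have "insert x (set xs) - {z} = insert x (set xs - {z})"
      using that x by auto
    then show ?thesis
      using x by simp
  qed
  have "(\<Sum>z\<in>set xs. \<Sum>y\<in>insert x (set xs) - {z}. f z y)
      = (\<Sum>z\<in>set xs. f z x) + (\<Sum>z\<in>set xs. \<Sum>y\<in>set xs - {z}. f z y)"
    by (simp add: split sum.distrib cong: sum.cong)
  also have "(\<Sum>z\<in>set xs. f z x) = (\<Sum>z\<in>set xs. f x z)"
    using Cons.prems x by (intro sum.cong) auto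
  finally have "(\<Sum>z\<in>set xs. \<Sum>y\<in>insert x (set xs) - {z}. f z y)
      = (\<Sum>z\<in>set xs. f x z) + 2 * psum f xs"
    using Cons by simp
  moreover have "(\<Sum>y\<leftarrow>xs. f x y) = (\<Sum>y\<in>set xs. f x y)"
    using Cons.prems by (simp add: sum_list_distinct_conv_sum_set)
  ultimately show ?case
    using x by simp
qed simp

lemma psum_perm:
  assumes "distinct xs" and "mset xs = mset ys"
    and sym: "\<And>x y. x \<in> set xs \<Longrightarrow> y \<in> set xs \<Longrightarrow> x \<noteq> y \<Longrightarrow> f x y = f y x"
  shows "psum f xs = psum f ys"
proof -
  have d: "distinct ys" "set ys = set xs"
    using assms mset_eq_imp_distinct_iff mset_eq_setD by blast+
  have "2 * psum f xs = 2 * psum f ys"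
    using psum_symmetric[OF assms(1) sym] psum_symmetric[OF d(1), of f] d(2) sym by auto
  then show ?thesis
    by simp
qed

lemma psum_sorted:
  assumes "sorted_wrt (<) xs"
  shows "psum f xs = (\<Sum>j\<in>set xs. \<Sum>k | k \<in> set xs \<and> j < (k::nat). f j k)"
  using assms
proof (induction xs)
  case (Cons x xs)
  have "(\<Sum>k | k \<in> set (x # xs) \<and> x < k. f x k) = (\<Sum>k\<in>set xs. f x k)"
    using Cons.prems by (intro sum.cong) auto
  moreover have "(\<Sum>k | k \<in> set (x # xs) \<and> j < k. f j k) = (\<Sum>k | k \<in> set xs \<and> j < k. f j k)"
    if "j \<in> set xs" for j
    using Cons.prems that by (intro sum.cong) auto
  moreover have "(\<Sum>y\<leftarrow>xs. f x y) = (\<Sum>y\<in>set xs. f x y)"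
    using Cons.prems by (simp add: sum_list_distinct_conv_sum_set strict_sorted_iff)
  moreover have "x \<notin> set xs"
    using Cons.prems by auto
  ultimately show ?case
    using Cons by (simp cong: sum.cong)
qed simp

text \<open>A pair of an outside element with \<open>j\<close> or \<open>k\<close> may change its
  value as long as the two values together keep their sum; an exchange of entries between two
  columns is compensated in this form. \<open>f\<close> will be the summand after the exchange and
  \<open>g\<close> the one before it.\<close>

lemma psum_swap:
  assumes d: "distinct (xs @ j # k # ys)"
    and same: "\<And>x y. x \<notin> {j, k} \<Longrightarrow> y \<notin> {j, k} \<Longrightarrow> x \<in> set (xs @ ys) \<Longrightarrow> y \<in> set (xs @ ys) \<Longrightarrow>
      f x y = g x y"
    and left: "\<And>x. x \<in> set xs \<Longrightarrow> f x j + f x k = g x j + g x k"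
    and right: "\<And>y. y \<in> set ys \<Longrightarrow> f j y + f k y = g j y + g k y"
    and mid: "f j k = g k j"
  shows "psum f (xs @ j # k # ys) = psum g (xs @ k # j # ys)"
proof -
  have 1: "psum f xs = psum g xs" "psum f ys = psum g ys"
    using d by (auto intro!: psum_cong same)
  have 2: "(\<Sum>y\<leftarrow>ys. f j y) + (\<Sum>y\<leftarrow>ys. f k y) = (\<Sum>y\<leftarrow>ys. g j y) + (\<Sum>y\<leftarrow>ys. g k y)"
    unfolding sum_list_addf[symmetric]
    using right by (intro arg_cong[of _ _ sum_list] map_cong) auto
  have 3: "(\<Sum>y\<leftarrow>ys. f x y) = (\<Sum>y\<leftarrow>ys. g x y)" if "x \<in> set xs" for x
    using d that by (intro arg_cong[of _ _ sum_list] map_cong refl same) auto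
  have 4: "(\<Sum>x\<leftarrow>xs. f x j + (f x k + (\<Sum>y\<leftarrow>ys. f x y)))
      = (\<Sum>x\<leftarrow>xs. g x k + (g x j + (\<Sum>y\<leftarrow>ys. g x y)))"
  proof (intro arg_cong[of _ _ sum_list] map_cong refl)
    fix x assume "x \<in> set xs"
    then show "f x j + (f x k + (\<Sum>y\<leftarrow>ys. f x y)) = g x k + (g x j + (\<Sum>y\<leftarrow>ys. g x y))"
      using left[of x] 3[of x] by linarith
  qed
  show ?thesis
    using 1 2 4 mid by (simp add: psum_append)
qed

text \<open>Bubble sort: a preorder that relates neighbouring transpositions relates any two
  arrangements of one multiset. Only arrangements of \<open>xs\<close> are swapped, so the swaps may
  rely on distinctness.\<close>

lemma adjacent_swaps_induct:
  assumes "mset xs = mset ys"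
    and refl: "\<And>xs. R xs xs"
    and trans: "\<And>xs ys zs. R xs ys \<Longrightarrow> R ys zs \<Longrightarrow> R xs zs"
    and swap: "\<And>ps x y qs. mset (ps @ x # y # qs) = mset xs \<Longrightarrow> R (ps @ x # y # qs) (ps @ y # x # qs)"
  shows "R xs ys"
proof -
  have move: "R (ps @ x # as @ bs) (ps @ as @ x # bs)"
    if "mset (ps @ x # as @ bs) = mset xs" for ps x as bs
    using that
  proof (induction as arbitrary: ps)
    case (Cons y as)
    have "R (ps @ x # y # as @ bs) (ps @ y # x # as @ bs)"
      using Cons.prems by (intro swap) (simp add: add_mset_commute[of x y])
    moreover have "R ((ps @ [y]) @ x # as @ bs) ((ps @ [y]) @ as @ x # bs)"
      using Cons.prems by (intro Cons.IH) (simp add: add_mset_commute[of x y])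
    ultimately show ?case
      using trans by simp
  qed (simp add: refl)
  \<comment> \<open>The first element of \<open>us\<close> is kept in front while the rest is
    brought into order by induction; then it is moved to its place in \<open>vs\<close>.\<close>
  have "R (ps @ us) (ps @ vs)" if "mset (ps @ us) = mset xs" "mset us = mset vs" for ps us vs
    using that
  proof (induction us arbitrary: ps vs)
    case (Cons u us)
    have "u \<in> set vs"
      using Cons.prems(2) by (metis list.set_intros(1) mset_eq_setD)
    then obtain as bs where vs: "vs = as @ u # bs"
      by (meson split_list)
    have eq: "mset us = mset (as @ bs)"
      using Cons.prems(2) vs by simp
    have "R ((ps @ [u]) @ us) ((ps @ [u]) @ as @ bs)"
      using Cons.prems(1) by (intro Cons.IH eq) simp
    moreover have "R (ps @ u # as @ bs) (ps @ as @ u # bs)"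
      using Cons.prems(1) eq by (intro move) simp
    ultimately show ?case
      using trans vs by simp
  qed (simp add: refl)
  from this[of "[]" xs ys] show ?thesis
    using assms(1) by simp
qed

section \<open>Equidistribution for a pair of adjacent rows\<close>

definition equidist :: "'a set \<Rightarrow> ('a \<Rightarrow> 'b) \<Rightarrow> ('a \<Rightarrow> 'b) \<Rightarrow> bool" where
  "equidist M s t \<longleftrightarrow> (\<exists>\<beta>. bij_betw \<beta> M M \<and> (\<forall>x\<in>M. t (\<beta> x) = s x))"

lemma equidist_refl: "(\<And>x. x \<in> M \<Longrightarrow> s x = t x) \<Longrightarrow> equidist M s t"
  unfolding equidist_def by (intro exI[of _ id]) auto

lemma equidist_trans: "equidist M s t \<Longrightarrow> equidist M t r \<Longrightarrow> equidist M s r"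
  unfolding equidist_def
  by (metis (no_types, lifting) bij_betw_trans bij_betwE comp_apply)

text \<open>The indicator of a queue inversion on finite entries, in additive form; it agrees with
  \<open>Q3\<close> when \<open>c\<close> differs from \<open>a\<close> and \<open>b\<close>
  (\<open>Q3_enat\<close>). Each term compares only two entries, so sums over columns can be
  regrouped.\<close>

definition Q :: "nat \<Rightarrow> nat \<Rightarrow> nat \<Rightarrow> int" where
  "Q a b c = of_bool (c < a) - of_bool (c < b) + of_bool (a \<le> b)"

text \<open>Exchanging \<open>u\<close> and \<open>v\<close> changes the number of descents exactly
  when one of \<open>z\<close>, \<open>w\<close> lies between \<open>u\<close> and \<open>v\<close>
  and the other does not. Up to sign, the difference of the two sides is 1 minus the number of
  \<open>z\<close>, \<open>w\<close> lying between, so it vanishes in this case.\<close>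

lemma Q_exchange:
  assumes "z \<noteq> u" "w \<noteq> v" "z \<noteq> v" "w \<noteq> u" "u \<noteq> v"
    and "of_bool (u < z) + of_bool (v < w) \<noteq> (of_bool (v < z) + of_bool (u < w) :: int)"
  shows "Q z u v = Q w v u"
  using assms unfolding Q_def by (cases "u < z"; cases "v < w"; cases "v < z"; cases "u < w") auto

text \<open>\<open>J\<close> is the set of columns of a rectangle, \<open>a\<close> the upper of two
  adjacent rows and \<open>B\<close> the set of entries of the lower one; the lower row itself
  varies.\<close>

locale row_pair =
  fixes J :: "nat set" and a :: "nat \<Rightarrow> nat" and B :: "nat set"
  assumes finite_J: "finite J" and inj_a: "inj_on a J"
begin

text \<open>These are the lower rows compatible with the non-attacking condition: an upper entry
  that recurs below must recur in its own column.\<close>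

definition lower_rows :: "(nat \<Rightarrow> nat) set" where
  "lower_rows = {u \<in> J \<rightarrow>\<^sub>E B. bij_betw u J B \<and> (\<forall>j\<in>J. a j \<in> B \<longrightarrow> u j = a j)}"

text \<open>The argument \<open>x\<close> stands for the lower entry of column \<open>j\<close>; the
  three classes share one type so that \<open>Qsum\<close> and \<open>flip\<close> can be stated for
  all of them at once.\<close>

definition free :: "nat \<Rightarrow> nat \<Rightarrow> bool" where "free j x \<longleftrightarrow> a j \<notin> B"
definition desc :: "nat \<Rightarrow> nat \<Rightarrow> bool" where "desc j x \<longleftrightarrow> a j \<notin> B \<and> x < a j"
definition asc :: "nat \<Rightarrow> nat \<Rightarrow> bool" where "asc j x \<longleftrightarrow> a j \<notin> B \<and> a j < x"

definition descents :: "(nat \<Rightarrow> nat) \<Rightarrow> int" where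
  "descents u = (\<Sum>j\<in>J. of_bool (u j < a j))"

definition Qsum :: "(nat \<Rightarrow> nat \<Rightarrow> bool) \<Rightarrow> nat list \<Rightarrow> (nat \<Rightarrow> nat) \<Rightarrow> int" where
  "Qsum P js u = psum (\<lambda>j k. if P j (u j) \<and> P k (u k) then Q (a j) (u j) (u k) else 0) js"

text \<open>The four memberships keep both columns in the class and let the exchange be undone; the
  last condition preserves the number of descents.\<close>

definition flippable :: "(nat \<Rightarrow> nat \<Rightarrow> bool) \<Rightarrow> nat \<Rightarrow> nat \<Rightarrow> (nat \<Rightarrow> nat) \<Rightarrow> bool" where
  "flippable P j k u \<longleftrightarrow> P j (u j) \<and> P k (u k) \<and> P j (u k) \<and> P k (u j) \<and>
     of_bool (u j < a j) + of_bool (u k < a k) = (of_bool (u k < a j) + of_bool (u j < a k) :: int)"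

definition flip :: "(nat \<Rightarrow> nat \<Rightarrow> bool) \<Rightarrow> nat \<Rightarrow> nat \<Rightarrow> (nat \<Rightarrow> nat) \<Rightarrow> nat \<Rightarrow> nat" where
  "flip P j k u = (if flippable P j k u then u(j := u k, k := u j) else u)"

lemma flip_flip: "flip P j k (flip P j k u) = u"
  by (cases "j = k") (auto simp: flip_def flippable_def fun_eq_iff)

lemma flip_lower_rows:
  assumes "u \<in> lower_rows" "j \<in> J" "k \<in> J" "P \<in> {free, desc, asc}"
  shows "flip P j k u \<in> lower_rows"
proof (cases "flippable P j k u")
  case True
  have nB: "a j \<notin> B" "a k \<notin> B"
    using True assms(4) by (auto simp: flippable_def free_def desc_def asc_def)
  have u: "u \<in> J \<rightarrow>\<^sub>E B" "bij_betw u J B" "\<forall>j\<in>J. a j \<in> B \<longrightarrow> u j = a j"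
    using assms(1) by (auto simp: lower_rows_def)
  have "u(j := u k, k := u j) = u \<circ> transpose j k"
    by (auto simp: fun_eq_iff transpose_def)
  moreover have "bij_betw (u \<circ> transpose j k) J B"
    using assms(2,3) u(2) by (intro bij_betw_trans[of _ J J]) auto
  ultimately have "bij_betw (u(j := u k, k := u j)) J B"
    by simp
  moreover have "u(j := u k, k := u j) \<in> J \<rightarrow>\<^sub>E B"
    using u(1) assms(2,3) by (auto simp: PiE_iff extensional_def)
  ultimately show ?thesis
    using True nB u(3) by (auto simp: flip_def lower_rows_def)
qed (simp add: flip_def assms)

lemma flip_bij:
  assumes "j \<in> J" "k \<in> J" "P \<in> {free, desc, asc}"
  shows "bij_betw (flip P j k) lower_rows lower_rows"
  by (rule bij_betw_byWitness[where f' = "flip P j k"])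
    (use assms in \<open>auto simp: flip_flip flip_lower_rows\<close>)

lemma descents_flip:
  assumes "j \<in> J" "k \<in> J" "j \<noteq> k"
  shows "descents (flip P j k u) = descents u"
proof (cases "flippable P j k u")
  case True
  have split: "(\<Sum>i\<in>J. f i) = f j + f k + (\<Sum>i\<in>J - {j} - {k}. f i)" for f :: "nat \<Rightarrow> int"
    using assms finite_J by (simp add: sum.remove[of J j] sum.remove[of "J - {j}" k])
  have "(\<Sum>i\<in>J - {j} - {k}. of_bool (flip P j k u i < a i))
      = (\<Sum>i\<in>J - {j} - {k}. of_bool (u i < a i) :: int)"
    using True by (intro sum.cong) (auto simp: flip_def)
  then show ?thesis
    using True assms(3) unfolding descents_def split by (auto simp: flip_def flippable_def)
qed (simp add: flip_def)

lemma
  assumes "u \<in> lower_rows" "j \<in> J" "k \<in> J" "j \<noteq> k"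
  shows lower_ne: "u j \<noteq> u k" and upper_ne: "a j \<noteq> a k"
    and cross_ne: "a j \<noteq> u k"
proof -
  have u: "u \<in> J \<rightarrow>\<^sub>E B" "bij_betw u J B" "\<forall>j\<in>J. a j \<in> B \<longrightarrow> u j = a j"
    using assms(1) by (auto simp: lower_rows_def)
  show ne: "u j \<noteq> u k"
    using u(2) assms by (auto simp: bij_betw_def inj_on_def)
  show "a j \<noteq> a k"
    using inj_a assms by (auto simp: inj_on_def)
  \<comment> \<open>An upper entry equal to a lower one lies in \<open>B\<close>, hence recurs in
    its own column, and the lower row is injective.\<close>
  show "a j \<noteq> u k"
    using u ne assms by (metis PiE_mem)
qed

lemma free_ne: "u \<in> lower_rows \<Longrightarrow> j \<in> J \<Longrightarrow> a j \<notin> B \<Longrightarrow> a j \<noteq> u j"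
  by (auto simp: lower_rows_def)

text \<open>Listing two neighbouring columns in the other order is undone by exchanging their lower
  entries. If these cannot be exchanged, \<open>Q_exchange\<close> shows that the order of the two
  makes no difference.\<close>

lemma Qsum_flip:
  assumes u: "u \<in> lower_rows" and d: "distinct (xs @ j # k # ys)" and J: "set (xs @ j # k # ys) = J"
    and P: "P \<in> {free, desc, asc}"
  shows "Qsum P (xs @ j # k # ys) (flip P j k u) = Qsum P (xs @ k # j # ys) u"
proof -
  have jk: "j \<noteq> k" "j \<in> J" "k \<in> J"
    using d J by auto
  have ne: "u j \<noteq> u k" "a j \<noteq> a k" "a j \<noteq> u k" "a k \<noteq> u j"
    using lower_ne[OF u jk(2,3,1)] upper_ne[OF u jk(2,3,1)] cross_ne[OF u jk(2,3,1)]
      cross_ne[OF u jk(3,2)] jk(1) by auto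
  show ?thesis
  proof (cases "flippable P j k u")
    case True
    then have P4: "P j (u j)" "P k (u k)" "P j (u k)" "P k (u j)"
      and eq: "of_bool (u j < a j) + of_bool (u k < a k)
        = (of_bool (u k < a j) + of_bool (u j < a k) :: int)"
      by (simp_all add: flippable_def)
    have flip: "flip P j k u = u(j := u k, k := u j)"
      using True by (simp add: flip_def)
    \<comment> \<open>Turns the last term of \<open>Q\<close> into a descent indicator; the
      conservation of descents then matches the sums for the outside columns and for the pair
      itself.\<close>
    have le: "of_bool (a i \<le> u l) = (1 - of_bool (u l < a i) :: int)" for i l
      by (simp add: not_less)
    show ?thesis
      unfolding Qsum_def flip
    proof (rule psum_swap[OF d], goal_cases)
      case (1 x y)
      then show ?case
        by simp
    next
      case (2 x)
      then show ?case
        using d P4 by auto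
    next
      case (3 y)
      then have "y \<noteq> j" "y \<noteq> k"
        using d by auto
      then show ?case
        using P4 eq jk(1) by (simp add: Q_def le)
    next
      case 4
      then show ?case
        using P4 eq jk(1) by (simp add: Q_def le)
    qed
  next
    case False
    have "Q (a j) (u j) (u k) = Q (a k) (u k) (u j)" if "P j (u j)" "P k (u k)"
    proof (rule Q_exchange)
      have "a j \<notin> B" "a k \<notin> B"
        using that P by (auto simp: free_def desc_def asc_def)
      then show "a j \<noteq> u j" "a k \<noteq> u k"
        using free_ne u jk by blast+
      \<comment> \<open>In the classes \<open>desc\<close> and \<open>asc\<close>, a membership that
        fails after the exchange is itself a change in the number of descents.\<close>
      then show "of_bool (u j < a j) + of_bool (u k < a k)
          \<noteq> (of_bool (u k < a j) + of_bool (u j < a k) :: int)"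
        using False that P ne by (auto simp: flippable_def free_def desc_def asc_def)
    qed (use ne in auto)
    then show ?thesis
      using False unfolding Qsum_def
      by (intro psum_swap[OF d]) (auto simp: flip_def)
  qed
qed

text \<open>\<open>R\<close> is any further statistic invariant under flips; it carries along the
  parts of a decomposition that are not being reordered.\<close>

lemma equidist_Qsum:
  assumes P: "P \<in> {free, desc, asc}" and xs: "mset xs = mset ys" "distinct xs" "set xs = J"
    and R: "\<And>j k u. j \<in> J \<Longrightarrow> k \<in> J \<Longrightarrow> j \<noteq> k \<Longrightarrow> u \<in> lower_rows \<Longrightarrow> R (flip P j k u) = R u"
  shows "equidist lower_rows (\<lambda>u. (descents u, Qsum P xs u + R u))
    (\<lambda>u. (descents u, Qsum P ys u + R u))"
  using xs(1)
proof (rule adjacent_swaps_induct)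
  fix ps x y qs
  assume m: "mset (ps @ x # y # qs) = mset xs"
  then have m': "mset (ps @ y # x # qs) = mset xs"
    by (simp add: add_mset_commute[of x y])
  have d: "distinct (ps @ y # x # qs)" "set (ps @ y # x # qs) = J"
    using m' xs(2,3) mset_eq_imp_distinct_iff mset_eq_setD by blast+
  then have "x \<in> J" "y \<in> J" "x \<noteq> y"
    by auto
  \<comment> \<open>\<open>Qsum_flip\<close> names the two columns in the order of the target list,
    hence the witness \<open>flip P y x\<close>.\<close>
  then show "equidist lower_rows (\<lambda>u. (descents u, Qsum P (ps @ x # y # qs) u + R u))
      (\<lambda>u. (descents u, Qsum P (ps @ y # x # qs) u + R u))"
    unfolding equidist_def using P d
    by (intro exI[of _ "flip P y x"])
      (auto simp: flip_bij descents_flip R Qsum_flip)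
qed (auto intro: equidist_refl equidist_trans)

end

section \<open>The eight ordering systems\<close>

text \<open>\<open>z\<close>, \<open>u\<close> are the entries of a descending column and
  \<open>w\<close>, \<open>v\<close> those of an ascending one. For fixed entries of one column,
  \<open>mixed1\<close> and \<open>mixed2\<close> are a function of the upper entry plus a function
  of the lower entry of the other, so exchanges inside either class preserve their sums.\<close>

definition mixed1 :: "nat \<Rightarrow> nat \<Rightarrow> nat \<Rightarrow> nat \<Rightarrow> int" where
  "mixed1 z u w v = of_bool (w < z) + of_bool (v < u) - of_bool (w < u)"

definition mixed2 :: "nat \<Rightarrow> nat \<Rightarrow> nat \<Rightarrow> nat \<Rightarrow> int" where
  "mixed2 z u w v = 1 - of_bool (w < z) + of_bool (v < z) - of_bool (v < u)"

text \<open>\<open>X\<close> and \<open>Y\<close> tell whether a pair of descending, respectively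
  ascending, columns is compared starting from the column with the larger upper entry.\<close>

definition decomposable :: "(nat \<Rightarrow> nat \<Rightarrow> nat \<Rightarrow> nat \<Rightarrow> int) \<Rightarrow> bool" where
  "decomposable g \<longleftrightarrow> (\<exists>X Y. \<exists>m\<in>{mixed1, mixed2}. \<forall>z w u v. distinct [z, w, u, v] \<longrightarrow>
     g z w u v = g w z v u \<and>
     (w < z \<longrightarrow> g z w u v =
       (if u < z \<and> v < w then if X then Q z u v else Q w v u
        else if z < u \<and> w < v then if Y then Q z u v else Q w v u
        else if u < z then m z u w v else m w v z u)))"

text \<open>The orderings of \<open>S_star\<close> force \<open>z = w\<close>, so for
  \<open>z \<noteq> w\<close> they hold in neither orientation and the symmetrisation may run over
  all of \<open>S\<close>.\<close>

lemma Q_sys_neq: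
  assumes "S \<in> ordering_systems" "z \<noteq> w"
  shows "Q_sys S z w u v = (if (\<exists>P\<in>S. P z w u v \<or> P w z v u) then 1 else 0)"
proof -
  have sub: "S_star \<subseteq> S"
    using assms(1) by (auto simp: ordering_systems_def)
  have "\<not> P w z v u" if "P \<in> S_star" for P
    using assms(2) that by (auto simp: S_star_def)
  then show ?thesis
    using sub unfolding Q_sys_def by (smt (verit) DiffD1 DiffI subset_iff)
qed

text \<open>A finite check over the relative orders of four distinct entries. True flags stand for
  the choices \<open>X1\<close>, \<open>Y2\<close>, \<open>Z2\<close>, that is, for comparison in
  decreasing order of the upper entries.\<close>

lemma decomposable_Q_sys:
  assumes "S \<in> ordering_systems"
  shows "decomposable (\<lambda>z w u v. int (Q_sys S (enat z) (enat w) (enat u) (enat v)))"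
proof -
  define G where "G X Y Z z w u v \<longleftrightarrow> (\<exists>P\<in>S_star \<union> S_common \<union> (if X then X1 else X2) \<union>
    (if Y then Y2 else Y1) \<union> (if Z then Z2 else Z1).
     P (enat z) (enat w) (enat u) (enat v) \<or> P (enat w) (enat z) (enat v) (enat u))"
    for X Y Z and z w u v :: nat
  obtain X Y Z where S: "S = S_star \<union> S_common \<union> (if X then X1 else X2) \<union>
    (if Y then Y2 else Y1) \<union> (if Z then Z2 else Z1)"
  proof -
    have "\<exists>X Y Z. S = S_star \<union> S_common \<union> (if X then X1 else X2) \<union>
      (if Y then Y2 else Y1) \<union> (if Z then Z2 else Z1)"
      using assms unfolding ordering_systems_def
      by (elim insertE emptyE) (simp_all add: ex_bool_eq)
    then show ?thesis
      using that by blast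
  qed
  have eq: "int (Q_sys S (enat z) (enat w) (enat u) (enat v)) = of_bool (G X Y Z z w u v)"
    if "z \<noteq> w" for z w u v
    using that Q_sys_neq[OF assms, of "enat z" "enat w" "enat u" "enat v"]
    unfolding G_def S[symmetric] by simp
  define E where "E z w u v \<longleftrightarrow>
      (z = w \<and> v < w \<and> u < v) \<or> (z \<le> u \<and> z = w \<and> v < w) \<or> (u < v \<and> z \<le> u \<and> z = w) \<or>
      (v < z \<and> w \<le> v \<and> u < w) \<or> (z \<le> u \<and> v < z \<and> w \<le> v) \<or>
      (if X then w < z \<and> v < w \<and> u < v else w < z \<and> u < w \<and> v < u) \<or>
      (if Y then u < v \<and> z \<le> u \<and> w < z else v < u \<and> z \<le> v \<and> w < z) \<or>
      (if Z then v < z \<and> u < v \<and> w \<le> u \<or> z \<le> u \<and> w < z \<and> v < w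
       else u < z \<and> v < u \<and> w \<le> v \<or> z \<le> v \<and> w < z \<and> u < w)" for z w u v :: nat
  have "(\<exists>P\<in>S. P (enat z) (enat w) (enat u) (enat v)) \<longleftrightarrow> E z w u v" for z w u v
    unfolding E_def S S_star_def S_common_def X1_def X2_def Y1_def Y2_def Z1_def Z2_def
    by (cases X; cases Y; cases Z)
      (simp_all only: bex_Un if_True if_False bex_simps enat_ord_simps enat.inject disj_assoc
        simp_thms)
  then have G_iff: "G X Y Z z w u v \<longleftrightarrow> E z w u v \<or> E w z v u" for z w u v
    unfolding G_def S[symmetric] by blast
  have val: "of_bool (G X Y Z z w u v) = 
       (if u < z \<and> v < w then if X then Q z u v else Q w v u
        else if z < u \<and> w < v then if Y then Q z u v else Q w v u
        else if u < z then (if Z then mixed2 else mixed1) z u w v 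
        else (if Z then mixed2 else mixed1) w v z u)"
    if "distinct [z, w, u, v]" "w < z" for z w u v
  proof -
    \<comment> \<open>Every ordering implies that its first argument is at least its second one, so
      only one orientation can hold.\<close>
    have "\<not> E w z v u"
      using that unfolding E_def by auto
    then have G: "G X Y Z z w u v \<longleftrightarrow> E z w u v"
      by (simp add: G_iff)
    have le: "z \<le> u \<longleftrightarrow> \<not> u < z" "z \<le> v \<longleftrightarrow> \<not> v < z" "w \<le> u \<longleftrightarrow> \<not> u < w" "w \<le> v \<longleftrightarrow> \<not> v < w"
      "v < u \<longleftrightarrow> \<not> u < v" "z < u \<longleftrightarrow> \<not> u < z" "w < v \<longleftrightarrow> \<not> v < w" "w < u \<longleftrightarrow> \<not> u < w" "z < w \<longleftrightarrow> False"
      using that by auto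
    \<comment> \<open>Consequences of transitivity that exclude the impossible combinations of the
      five comparisons on which the cases are split.\<close>
    have "u < z \<or> \<not> u < w" "v < z \<or> \<not> v < w" "u < w \<or> \<not> u < v \<or> \<not> v < w" "u < z \<or> \<not> u < v \<or> \<not> v < z"
      "v < w \<or> u < v \<or> \<not> u < w" "v < z \<or> u < v \<or> \<not> u < z" "w < z" "z \<noteq> w"
      using that by auto
    then show ?thesis
      unfolding G E_def Q_def mixed1_def mixed2_def le if_distrib[where f = "\<lambda>m. m _ _ _ _"]
      by (cases "u < z"; cases "v < w"; cases "v < z"; cases "u < w"; cases "u < v") simp_all
  qed
  have sym: "G X Y Z z w u v = G X Y Z w z v u" for z w u v
    unfolding G_def by blast
  show ?thesis
    unfolding decomposable_def
    by (rule exI[of _ X], rule exI[of _ Y], rule bexI[of _ "if Z then mixed2 else mixed1"])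
      (auto simp: eq sym val simp del: of_bool_eq_iff)
qed

section \<open>Descending, ascending and mixed pairs of columns\<close>

context row_pair
begin

definition mixed :: "(nat \<Rightarrow> nat \<Rightarrow> nat \<Rightarrow> nat \<Rightarrow> int) \<Rightarrow> nat \<Rightarrow> nat \<Rightarrow> (nat \<Rightarrow> nat) \<Rightarrow> int" where
  "mixed m j k u =
     (if desc j (u j) \<and> asc k (u k) then m (a j) (u j) (a k) (u k)
      else if asc j (u j) \<and> desc k (u k) then m (a k) (u k) (a j) (u j) else 0)"

definition mixed_sum :: "(nat \<Rightarrow> nat \<Rightarrow> nat \<Rightarrow> nat \<Rightarrow> int) \<Rightarrow> nat list \<Rightarrow> (nat \<Rightarrow> nat) \<Rightarrow> int" where
  "mixed_sum m js u = psum (\<lambda>j k. mixed m j k u) js"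

lemma not_asc_and_desc: "asc j x \<Longrightarrow> \<not> desc j x"
  by (simp add: asc_def desc_def)

lemma mixed_commute: "mixed m j k u = mixed m k j u"
  by (auto simp: mixed_def dest: not_asc_and_desc)

lemma mixed_sum_perm: "mset xs = mset ys \<Longrightarrow> distinct xs \<Longrightarrow> mixed_sum m xs u = mixed_sum m ys u"
  unfolding mixed_sum_def by (rule psum_perm) (auto intro: mixed_commute)

lemma mixed_sum_flip:
  assumes m: "m \<in> {mixed1, mixed2}" and js: "distinct js" "j \<in> set js" "k \<in> set js" "j \<noteq> k"
    and P: "P \<in> {desc, asc}"
  shows "mixed_sum m js (flip P j k u) = mixed_sum m js u"
proof (cases "flippable P j k u")
  case True
  then have P4: "P j (u j)" "P k (u k)" "P j (u k)" "P k (u j)"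
    by (simp_all add: flippable_def)
  have flip: "flip P j k u = u(j := u k, k := u j)"
    using True by (simp add: flip_def)
  have m_upper: "m z u w v + m z' u' w v = m z u' w v + m z' u w v" for z z' u u' w v
    using m by (auto simp: mixed1_def mixed2_def)
  have m_lower: "m z u w v + m z u w' v' = m z u w v' + m z u w' v" for z u w w' v v'
    using m by (auto simp: mixed1_def mixed2_def)
  \<comment> \<open>\<open>mixed_sum\<close> is independent of the order of the list, so
    \<open>j\<close> and \<open>k\<close> may be brought to the front, where
    \<open>psum_swap\<close> applies.\<close>
  define ys where "ys = remove1 k (remove1 j js)"
  have perm: "mset js = mset (j # k # ys)"
  proof -
    have "mset js = add_mset j (mset (remove1 j js))"
      using js(2) by simp
    moreover have "k \<in> set (remove1 j js)"
      using js by (simp add: in_set_remove1)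
    then have "mset (remove1 j js) = add_mset k (mset ys)"
      unfolding ys_def by (metis insert_DiffM mset_remove1 set_mset_mset)
    ultimately show ?thesis
      by simp
  qed
  then have d: "distinct ([] @ j # k # ys)"
    using js(1) mset_eq_imp_distinct_iff[OF perm] by simp
  have "mixed_sum m ([] @ j # k # ys) (flip P j k u) = mixed_sum m ([] @ k # j # ys) u"
    unfolding mixed_sum_def flip
  proof (rule psum_swap[OF d], goal_cases)
    case (1 x y)
    then show ?case
      by (simp add: mixed_def)
  next
    case (2 x)
    then show ?case
      by simp
  next
    case (3 y)
    then have y: "y \<noteq> j" "y \<noteq> k"
      using d by auto
    show ?case
    proof (cases "P = desc")
      case True
      then show ?thesis
        using P4 y js(4) not_asc_and_desc m_upper[of "a j" "u k" "a y" "u y" "a k" "u j"]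
        by (auto simp: mixed_def)
    next
      case False
      then have "P = asc"
        using P by simp
      then show ?thesis
        using P4 y js(4) not_asc_and_desc m_lower[of "a y" "u y" "a j" "u k" "a k" "u j"]
        by (auto simp: mixed_def)
    qed
  next
    case 4
    then show ?case
      using P4 P js(4) not_asc_and_desc by (auto simp: mixed_def)
  qed
  then show ?thesis
    using perm js(1) d mixed_sum_perm[of js "j # k # ys"] mixed_sum_perm[of "k # j # ys" "j # k # ys"]
    by (simp add: add_mset_commute[of k j])
qed (simp add: flip_def)

text \<open>The exchanged columns belong to \<open>P\<close> before and after, hence never to
  \<open>P'\<close>, and no term of the other sum sees them.\<close>

lemma Qsum_flip_other:
  assumes "(P, P') \<in> {(desc, asc), (asc, desc)}" "j \<noteq> k"
  shows "Qsum P' js (flip P j k u) = Qsum P' js u"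
proof (cases "flippable P j k u")
  case True
  then have P4: "P j (u j)" "P k (u k)" "P j (u k)" "P k (u j)"
    by (simp_all add: flippable_def)
  have flip: "flip P j k u = u(j := u k, k := u j)"
    using True by (simp add: flip_def)
  have "\<not> P' j (u j)" "\<not> P' k (u k)" "\<not> P' j (u k)" "\<not> P' k (u j)"
    using P4 assms not_asc_and_desc by auto
  then show ?thesis
    unfolding Qsum_def flip using assms(2)
    by (intro arg_cong[of _ _ "\<lambda>f. psum f js"] ext) auto
qed (simp add: flip_def)

definition cols :: "nat list" where
  "cols = sort_key a (sorted_list_of_set J)"

lemma cols: "set cols = J" "distinct cols" "sorted_wrt (\<lambda>j k. a j < a k) cols"
proof -
  show 1: "set cols = J" "distinct cols"
    using finite_J by (simp_all add: cols_def)
  have "sorted (map a cols)"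
    by (simp add: cols_def)
  moreover have "distinct (map a cols)"
    using 1 inj_a by (simp add: distinct_map)
  ultimately show "sorted_wrt (\<lambda>j k. a j < a k) cols"
    using strict_sorted_iff[of "map a cols"] by (simp add: sorted_wrt_map)
qed

definition split_sum ::
  "(nat \<Rightarrow> nat \<Rightarrow> nat \<Rightarrow> nat \<Rightarrow> int) \<Rightarrow> nat list \<Rightarrow> nat list \<Rightarrow> (nat \<Rightarrow> nat) \<Rightarrow> int" where
  "split_sum m xs ys u = Qsum desc xs u + Qsum asc ys u + mixed_sum m cols u"

text \<open>The two classes are reordered one after the other; the remaining two summands are
  invariant under the flips of the class being treated.\<close>

lemma equidist_split_sum:
  assumes m: "m \<in> {mixed1, mixed2}"
    and xs: "mset xs = mset xs'" "distinct xs" "set xs = J"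
    and ys: "mset ys = mset ys'" "distinct ys" "set ys = J"
  shows "equidist lower_rows (\<lambda>u. (descents u, split_sum m xs ys u))
    (\<lambda>u. (descents u, split_sum m xs' ys' u))"
proof -
  have "equidist lower_rows
      (\<lambda>u. (descents u, Qsum desc xs u + (Qsum asc ys u + mixed_sum m cols u)))
      (\<lambda>u. (descents u, Qsum desc xs' u + (Qsum asc ys u + mixed_sum m cols u)))"
    using xs m cols by (intro equidist_Qsum) (simp_all add: mixed_sum_flip Qsum_flip_other)
  moreover have "equidist lower_rows
      (\<lambda>u. (descents u, Qsum asc ys u + (Qsum desc xs' u + mixed_sum m cols u)))
      (\<lambda>u. (descents u, Qsum asc ys' u + (Qsum desc xs' u + mixed_sum m cols u)))"
    using ys m cols by (intro equidist_Qsum) (simp_all add: mixed_sum_flip Qsum_flip_other)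
  ultimately show ?thesis
    using equidist_trans by (simp add: split_sum_def ac_simps) blast
qed

lemma Qsum_rev:
  "Qsum P (rev js) u = psum (\<lambda>j k. if P j (u j) \<and> P k (u k) then Q (a k) (u k) (u j) else 0) js"
  unfolding Qsum_def psum_rev by (intro arg_cong[of _ _ "\<lambda>f. psum f js"] ext) auto

lemma row_values_distinct:
  assumes "u \<in> lower_rows" "j \<in> J" "k \<in> J" "j \<noteq> k" "a j \<notin> B" "a k \<notin> B"
  shows "distinct [a k, a j, u k, u j]"
  using lower_ne[of u j k] upper_ne[of u j k] cross_ne[of u j k] cross_ne[of u k j]
    free_ne[of u j] free_ne[of u k] assms by auto

text \<open>\<open>mixed1\<close> and \<open>mixed2\<close> give the value of \<open>Q\<close> on
  mixed pairs when the columns are read by increasing, respectively decreasing, upper entry.\<close>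

lemma Qsum_free_eq_split_sum:
  assumes u: "u \<in> lower_rows"
  shows "Qsum free cols u = split_sum mixed1 cols cols u"
    and "Qsum free (rev cols) u = split_sum mixed2 (rev cols) (rev cols) u"
proof -
  have *: "(if free j (u j) \<and> free k (u k) then Q (a j) (u j) (u k) else 0) =
      (if desc j (u j) \<and> desc k (u k) then Q (a j) (u j) (u k) else 0) +
      (if asc j (u j) \<and> asc k (u k) then Q (a j) (u j) (u k) else 0) + mixed mixed1 j k u"
    "(if free j (u j) \<and> free k (u k) then Q (a k) (u k) (u j) else 0) =
      (if desc j (u j) \<and> desc k (u k) then Q (a k) (u k) (u j) else 0) +
      (if asc j (u j) \<and> asc k (u k) then Q (a k) (u k) (u j) else 0) + mixed mixed2 j k u"
    if "j \<in> J" "k \<in> J" "a j < a k" for j k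
  proof -
    consider "a j \<in> B" | "a k \<in> B" | "a j \<notin> B" "a k \<notin> B"
      by blast
    note c = this
    have d: "distinct [a k, a j, u k, u j]" if "a j \<notin> B" "a k \<notin> B"
      using row_values_distinct u that \<open>j \<in> J\<close> \<open>k \<in> J\<close> \<open>a j < a k\<close> by blast
    show "(if free j (u j) \<and> free k (u k) then Q (a j) (u j) (u k) else 0) =
      (if desc j (u j) \<and> desc k (u k) then Q (a j) (u j) (u k) else 0) +
      (if asc j (u j) \<and> asc k (u k) then Q (a j) (u j) (u k) else 0) + mixed mixed1 j k u"
      using c
    proof cases
      case 3
      then show ?thesis
        using d[OF 3] \<open>a j < a k\<close>
        by (cases "u k < a k"; cases "u j < a j"; cases "u k < a j"; cases "u j < a k")
          (auto simp: free_def desc_def asc_def mixed_def mixed1_def Q_def)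
    qed (auto simp: free_def desc_def asc_def mixed_def)
    show "(if free j (u j) \<and> free k (u k) then Q (a k) (u k) (u j) else 0) =
      (if desc j (u j) \<and> desc k (u k) then Q (a k) (u k) (u j) else 0) +
      (if asc j (u j) \<and> asc k (u k) then Q (a k) (u k) (u j) else 0) + mixed mixed2 j k u"
      using c
    proof cases
      case 3
      then show ?thesis
        using d[OF 3] \<open>a j < a k\<close>
        by (cases "u k < a k"; cases "u j < a j"; cases "u k < a j"; cases "u j < a k")
          (auto simp: free_def desc_def asc_def mixed_def mixed2_def Q_def)
    qed (auto simp: free_def desc_def asc_def mixed_def)
  qed
  show "Qsum free cols u = split_sum mixed1 cols cols u"
    unfolding split_sum_def Qsum_def mixed_sum_def psum_add[symmetric]
    using cols * by (intro psum_cong_wrt[OF cols(3)]) simp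
  show "Qsum free (rev cols) u = split_sum mixed2 (rev cols) (rev cols) u"
    unfolding split_sum_def Qsum_rev mixed_sum_def psum_add[symmetric]
    using cols * by (intro psum_cong_wrt[OF cols(3)]) simp
qed

definition pair_sum ::
  "(nat \<Rightarrow> nat \<Rightarrow> nat \<Rightarrow> nat \<Rightarrow> int) \<Rightarrow> nat list \<Rightarrow> (nat \<Rightarrow> nat) \<Rightarrow> int" where
  "pair_sum g js u =
     psum (\<lambda>j k. if a j \<notin> B \<and> a k \<notin> B then g (a j) (a k) (u j) (u k) else 0) js"

text \<open>A symmetric summand may be summed along \<open>cols\<close>; there a true flag
  \<open>X\<close> or \<open>Y\<close> means that the pairs of that class are read backwards.
  \<open>m\<close> and the two orders are chosen uniformly in \<open>u\<close>.\<close>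

lemma pair_sum_decomposable:
  assumes "decomposable g" and js: "distinct js" "set js = J"
  shows "\<exists>m\<in>{mixed1, mixed2}. \<exists>xs\<in>{cols, rev cols}. \<exists>ys\<in>{cols, rev cols}. \<forall>u\<in>lower_rows.
    pair_sum g js u = split_sum m xs ys u"
proof -
  obtain X Y m where m: "m \<in> {mixed1, mixed2}"
    and *: "\<forall>z w u v. distinct [z, w, u, v] \<longrightarrow>
     g z w u v = g w z v u \<and>
     (w < z \<longrightarrow> g z w u v =
       (if u < z \<and> v < w then if X then Q z u v else Q w v u
        else if z < u \<and> w < v then if Y then Q z u v else Q w v u
        else if u < z then m z u w v else m w v z u))"
    using assms(1) unfolding decomposable_def by blast
  have g_sym: "g z w u v = g w z v u" if "distinct [z, w, u, v]" for z w u v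
    using * that by blast
  have g: "g z w u v =
       (if u < z \<and> v < w then if X then Q z u v else Q w v u
        else if z < u \<and> w < v then if Y then Q z u v else Q w v u
        else if u < z then m z u w v else m w v z u)"
    if "distinct [z, w, u, v]" "w < z" for z w u v
    using * that by blast
  define ord where "ord D = (if D then rev cols else cols)" for D
  have Qsum_ord: "Qsum P (ord D) u = psum (\<lambda>j k. if P j (u j) \<and> P k (u k)
      then if D then Q (a k) (u k) (u j) else Q (a j) (u j) (u k) else 0) cols" for P D u
    by (cases D) (simp_all only: ord_def Qsum_rev if_True if_False, simp add: Qsum_def)
  have "pair_sum g js u = split_sum m (ord X) (ord Y) u" if u: "u \<in> lower_rows" for u
  proof -
    have "mset js = mset cols"
      using js cols set_eq_iff_mset_eq_distinct by blast
    then have "pair_sum g js u = pair_sum g cols u"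
      unfolding pair_sum_def
    proof (rule psum_perm[OF js(1)], goal_cases)
      case (1 j k)
      show ?case
      proof (cases "a j \<notin> B \<and> a k \<notin> B")
        case True
        then have "distinct [a k, a j, u k, u j]"
          using row_values_distinct u 1 js by blast
        then show ?thesis
          using g_sym by auto
      qed auto
    qed
    also have "\<dots> = split_sum m (ord X) (ord Y) u"
      unfolding pair_sum_def split_sum_def Qsum_ord mixed_sum_def psum_add[symmetric]
    proof (rule psum_cong_wrt[OF cols(3)])
      fix j k assume jk: "j \<in> set cols" "k \<in> set cols" "a j < a k"
      show "(if a j \<notin> B \<and> a k \<notin> B then g (a j) (a k) (u j) (u k) else 0) =
        (if desc j (u j) \<and> desc k (u k)
          then if X then Q (a k) (u k) (u j) else Q (a j) (u j) (u k) else 0) +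
        (if asc j (u j) \<and> asc k (u k)
          then if Y then Q (a k) (u k) (u j) else Q (a j) (u j) (u k) else 0) +
        mixed m j k u"
      proof (cases "a j \<notin> B \<and> a k \<notin> B")
        case True
        then have d: "distinct [a k, a j, u k, u j]"
          using row_values_distinct u jk cols(1) by blast
        then have "g (a j) (a k) (u j) (u k) = g (a k) (a j) (u k) (u j)"
          using g_sym by auto
        then show ?thesis
          using True d g[OF d jk(3)] by (auto simp: desc_def asc_def mixed_def)
      qed (auto simp: desc_def asc_def mixed_def)
    qed
    finally show ?thesis .
  qed
  then show ?thesis
    using m by (intro bexI[of _ m] bexI[of _ "ord X"] bexI[of _ "ord Y"]) (auto simp: ord_def)
qed

lemma equidist_Qsum_pair_sum:
  assumes "decomposable g" and js: "distinct js" "set js = J"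
  shows "equidist lower_rows (\<lambda>u. (descents u, Qsum free js u))
    (\<lambda>u. (descents u, pair_sum g js u))"
proof -
  obtain m xs ys where m: "m \<in> {mixed1, mixed2}" and xs: "xs \<in> {cols, rev cols}"
    and ys: "ys \<in> {cols, rev cols}" and g: "\<forall>u\<in>lower_rows. pair_sum g js u = split_sum m xs ys u"
    using pair_sum_decomposable[OF assms] by blast
  \<comment> \<open>The order in which \<open>Qsum free\<close> already has mixed part
    \<open>m\<close>; from there only the descending and the ascending pairs are left to
    reorder.\<close>
  define zs where "zs = (if m = mixed1 then cols else rev cols)"
  have perm: "mset js = mset zs" "mset zs = mset xs" "mset zs = mset ys"
    using js cols xs ys set_eq_iff_mset_eq_distinct[of js cols] by (auto simp: zs_def)
  have zs: "distinct zs" "set zs = J"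
    using cols by (auto simp: zs_def)
  have "equidist lower_rows (\<lambda>u. (descents u, Qsum free js u)) (\<lambda>u. (descents u, Qsum free zs u))"
    using equidist_Qsum[of free js zs "\<lambda>_. 0"] js perm by simp
  moreover have "equidist lower_rows (\<lambda>u. (descents u, Qsum free zs u))
      (\<lambda>u. (descents u, split_sum m zs zs u))"
    using m Qsum_free_eq_split_sum by (intro equidist_refl) (auto simp: zs_def)
  moreover have "equidist lower_rows (\<lambda>u. (descents u, split_sum m zs zs u))
      (\<lambda>u. (descents u, split_sum m xs ys u))"
    using equidist_split_sum m perm zs by blast
  moreover have "equidist lower_rows (\<lambda>u. (descents u, split_sum m xs ys u))
      (\<lambda>u. (descents u, pair_sum g js u))"
    using g by (intro equidist_refl) simp
  ultimately show ?thesis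
    using equidist_trans by blast
qed

end

section \<open>Quadruples and restricted columns\<close>

definition quad :: "(nat \<Rightarrow> nat \<Rightarrow> nat \<Rightarrow> nat \<Rightarrow> int) \<Rightarrow> nat \<Rightarrow> nat \<Rightarrow> nat \<Rightarrow> nat \<Rightarrow> int" where
  "quad g z w u v = (if z = u \<or> w = v then 1 else g z w u v)"

definition quadQ :: "nat \<Rightarrow> nat \<Rightarrow> nat \<Rightarrow> nat \<Rightarrow> int" where
  "quadQ = quad (\<lambda>z w u v. Q z u v)"

definition quadS :: "ordering4 set \<Rightarrow> nat \<Rightarrow> nat \<Rightarrow> nat \<Rightarrow> nat \<Rightarrow> int" where
  "quadS S = quad (\<lambda>z w u v. int (Q_sys S (enat z) (enat w) (enat u) (enat v)))"

text \<open>A column is restricted exactly when \<open>a j \<in> B\<close>, for all lower rows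
  alike. So the quadruples meeting a restricted column contribute the constant \<open>K\<close>, and
  the others are covered by \<open>equidist_Qsum_pair_sum\<close>.\<close>

lemma (in row_pair) equidist_quad:
  assumes "decomposable g" and js: "distinct js" "set js = J"
  shows "equidist lower_rows
    (\<lambda>u. (descents u, psum (\<lambda>j k. quadQ (a j) (a k) (u j) (u k)) js))
    (\<lambda>u. (descents u, psum (\<lambda>j k. quad g (a j) (a k) (u j) (u k)) js))"
proof -
  define K where "K = psum (\<lambda>j k. if a j \<in> B \<or> a k \<in> B then 1 else 0) js"
  have split: "psum (\<lambda>j k. quad f (a j) (a k) (u j) (u k)) js =
      psum (\<lambda>j k. if a j \<notin> B \<and> a k \<notin> B then f (a j) (a k) (u j) (u k) else 0) js + K"
    if "u \<in> lower_rows" for f u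
    unfolding K_def psum_add[symmetric]
  proof (rule psum_cong[OF js(1)])
    fix j k assume "j \<in> set js" "k \<in> set js"
    moreover have "a j = u j \<longleftrightarrow> a j \<in> B" if "j \<in> J" for j
      using \<open>u \<in> lower_rows\<close> that by (auto simp: lower_rows_def)
    ultimately show "quad f (a j) (a k) (u j) (u k) =
        (if a j \<notin> B \<and> a k \<notin> B then f (a j) (a k) (u j) (u k) else 0) +
        (if a j \<in> B \<or> a k \<in> B then 1 else 0)"
      using js(2) by (auto simp: quad_def)
  qed
  obtain \<beta> where \<beta>: "bij_betw \<beta> lower_rows lower_rows"
    and eq: "\<And>u. u \<in> lower_rows \<Longrightarrow>
      descents (\<beta> u) = descents u \<and> pair_sum g js (\<beta> u) = Qsum free js u"
    using equidist_Qsum_pair_sum[OF assms] unfolding equidist_def by auto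
  have "descents (\<beta> u) = descents u \<and> psum (\<lambda>j k. quad g (a j) (a k) (\<beta> u j) (\<beta> u k)) js =
      psum (\<lambda>j k. quadQ (a j) (a k) (u j) (u k)) js" if u: "u \<in> lower_rows" for u
  proof -
    have "\<beta> u \<in> lower_rows"
      using \<beta> u bij_betwE by blast
    then show ?thesis
      using eq[OF u] split u by (simp add: quadQ_def pair_sum_def Qsum_def free_def)
  qed
  then show ?thesis
    unfolding equidist_def using \<beta> by auto
qed

lemma Q3_enat:
  assumes "a \<noteq> c" "b \<noteq> c"
  shows "int (Q3 (enat a) (enat b) (enat c)) = Q a b c"
  using assms unfolding Q3_def Q_def I_ind_def
  by (cases "b < a"; cases "b < c"; cases "c < a") auto

lemma Q4_enat:
  assumes "z \<noteq> w" "u \<noteq> v" "z \<noteq> v" "w \<noteq> u"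
  shows "int (Q4 (enat z) (enat w) (enat u) (enat v)) = quadQ z w u v"
  using assms Q3_enat[of z v u] by (auto simp: Q4_def quadQ_def quad_def Q_def)

lemma Q_sys_01: "Q_sys S z w u v = 0 \<or> Q_sys S z w u v = 1"
  by (simp add: Q_sys_def)

lemma Q4_01: "Q4 z w u v = 0 \<or> Q4 z w u v = 1"
  by (simp add: Q4_def Q3_def)

text \<open>The second indicator is the contribution to \<open>alpha\<close>. For entries that do
  not attack each other a repetition can only occur within a column, and then exactly one of the two
  indicators is 1.\<close>

lemma Q_sys_enat:
  assumes "z \<noteq> w" "u \<noteq> v" "z \<noteq> v" "w \<noteq> u"
  shows "of_bool (Q_sys S (enat z) (enat w) (enat u) (enat v) = 1) +
    of_bool (Q_sys S (enat z) (enat w) (enat u) (enat v) = 0 \<and> \<not> distinct [enat z, enat w, enat u, enat v])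
    = quadS S z w u v"
  using assms Q_sys_01[of S "enat z" "enat w" "enat u" "enat v"]
  by (auto simp: quadS_def quad_def)

lemma Q4_top:
  assumes "0 < u" "u < v"
  shows "Q4 0 0 (enat u) (enat v) = 1"
  using assms by (auto simp: Q4_def Q3_def I_ind_def zero_enat_def)

lemma Q4_bottom: "z \<noteq> w \<Longrightarrow> Q4 (enat z) (enat w) \<infinity> \<infinity> = 0"
  by (auto simp: Q4_def Q3_def I_ind_def)

text \<open>Every ordering puts some lower entry strictly below another entry, which is impossible
  if both lower entries are \<infinity>.\<close>

lemma Q_sys_bottom:
  assumes "S \<in> ordering_systems" "z \<noteq> w"
  shows "Q_sys S (enat z) (enat w) \<infinity> \<infinity> = 0"
proof -
  have "\<not> P (enat z) (enat w) \<infinity> \<infinity>" if "P \<in> S" for P z w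
    using that assms(1)
    by (auto simp: ordering_systems_def S_star_def S_common_def X1_def X2_def Y1_def Y2_def
        Z1_def Z2_def)
  then show ?thesis
    using assms by (auto simp: Q_sys_neq)
qed

text \<open>The ranks of the elements of \<open>V\<close> run once through all numbers below
  \<open>card V\<close>. Up to a constant, they will be the arms of the unrestricted boxes in a row
  of a rectangle.\<close>

lemma prod_rank:
  fixes V :: "nat set"
  assumes "finite V"
  shows "(\<Prod>j\<in>V. g (card {k \<in> V. k < j})) = (\<Prod>m<card V. g m)"
  using assms
proof (induction V rule: finite_linorder_max_induct)
  case (insert b A)
  have "{k \<in> insert b A. k < j} = {k \<in> A. k < j}" if "j \<in> A" for j
    using insert.hyps that by auto
  moreover have "{k \<in> insert b A. k < b} = A"
    using insert.hyps by auto
  moreover have "b \<notin> A"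
    using insert.hyps by auto
  ultimately show ?case
    using insert by (simp add: mult.commute cong: prod.cong)
qed simp

section \<open>Reduction to single rectangles\<close>

locale diagram =
  fixes lam :: "nat list"
  assumes partition: "is_partition lam"
begin

definition level :: "nat \<Rightarrow> nat set" where
  "level h = {j. 1 \<le> j \<and> j \<le> length lam \<and> ht lam j = h}"

lemma finite_level [simp]: "finite (level h)"
  by (rule finite_subset[of _ "{..length lam}"]) (auto simp: level_def)

lemma ht_in_set: "1 \<le> j \<Longrightarrow> j \<le> length lam \<Longrightarrow> ht lam j \<in> set lam"
  by (simp add: ht_def)

lemma ht_pos: "1 \<le> j \<Longrightarrow> j \<le> length lam \<Longrightarrow> 0 < ht lam j"
  using partition ht_in_set by (simp add: is_partition_def)

lemma ht_antimono: "1 \<le> j \<Longrightarrow> j \<le> k \<Longrightarrow> k \<le> length lam \<Longrightarrow> ht lam k \<le> ht lam j"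
  using partition sorted_wrt_nth_less[of "(\<ge>)" lam "j - 1" "k - 1"]
  by (cases "j = k") (auto simp: is_partition_def ht_def)

lemma taller_imp_less:
  "1 \<le> j \<Longrightarrow> j \<le> length lam \<Longrightarrow> 1 \<le> k \<Longrightarrow> k \<le> length lam \<Longrightarrow> ht lam k < ht lam j \<Longrightarrow> j < k"
  using ht_antimono[of k j] by (cases "j < k") auto

lemma bij_dg:
  "bij_betw (\<lambda>(h, u). u) (SIGMA h:set lam. {1..h} \<times> level h) (dg lam)"
  by (rule bij_betw_byWitness[where f' = "\<lambda>(i, j). (ht lam j, i, j)"])
    (auto simp: dg_def level_def ht_in_set)

lemma sum_dg:
  "(\<Sum>u\<in>dg lam. f u) = (\<Sum>h\<in>set lam. \<Sum>i=1..h. \<Sum>j\<in>level h. f (i, j))"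
  unfolding sum.reindex_bij_betw[OF bij_dg, symmetric]
  by (simp add: sum.Sigma sum.cartesian_product case_prod_unfold)

lemma prod_dg:
  "(\<Prod>u\<in>dg lam. f u) = (\<Prod>h\<in>set lam. \<Prod>i=1..h. \<Prod>j\<in>level h. f (i, j))"
  unfolding prod.reindex_bij_betw[OF bij_dg, symmetric]
  by (simp add: prod.Sigma prod.cartesian_product case_prod_unfold)

lemma finite_dg: "finite (dg lam)"
  using bij_betw_finite[OF bij_dg] by simp

lemma leg_eq:
  assumes "j \<in> level h" "1 \<le> i" "i \<le> h"
  shows "leg lam (i, j) = h - i"
proof -
  have "{i'. fst (i, j) < i' \<and> (i', snd (i, j)) \<in> dg lam} = {i<..h}"
    using assms by (auto simp: dg_def level_def)
  then show ?thesis
    by (simp add: leg_def)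
qed

definition admissible :: "filling \<Rightarrow> bool" where
  "admissible \<tau> \<longleftrightarrow> \<tau> \<in> positive_fillings lam \<and> non_attacking lam \<tau> \<and> top_row_increasing lam \<tau>"

lemma admissible_pos:
  assumes "admissible \<tau>" "j \<in> level h" "1 \<le> i" "i \<le> h"
  shows "0 < \<tau> (i, j)"
proof -
  have "(i, j) \<in> dg lam"
    using assms by (auto simp: dg_def level_def)
  then show ?thesis
    using assms(1) unfolding admissible_def positive_fillings_def by fastforce
qed

lemma non_attackingD:
  assumes "non_attacking lam \<tau>" "u \<in> dg lam" "v \<in> dg lam" "attacking lam u v"
  shows "\<tau> u \<noteq> \<tau> v"
  using assms unfolding non_attacking_def by blast

lemma admissible_row_neq:
  assumes "admissible \<tau>" "j \<in> level h" "k \<in> level h'" "j \<noteq> k" "1 \<le> i" "i \<le> h" "i \<le> h'"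
  shows "\<tau> (i, j) \<noteq> \<tau> (i, k)"
  using assms
  by (intro non_attackingD) (auto simp: admissible_def attacking_def dg_def level_def)

lemma admissible_inj: "admissible \<tau> \<Longrightarrow> 1 \<le> i \<Longrightarrow> i \<le> h \<Longrightarrow> inj_on (\<lambda>j. \<tau> (i, j)) (level h)"
  using admissible_row_neq by (intro inj_onI) blast

text \<open>Heights decrease to the right, so for \<open>h' < h\<close> the upper box lies further
  left and attacks; for equal heights the two diagonal conditions cover both directions.\<close>

lemma admissible_diag_neq:
  assumes "admissible \<tau>" "j \<in> level h" "k \<in> level h'" "j \<noteq> k" "1 \<le> i" "i < h" "i \<le> h'" "h' \<le> h"
  shows "\<tau> (i + 1, j) \<noteq> \<tau> (i, k)"
proof (rule non_attackingD)
  have "j < k \<or> h = h'"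
    using assms taller_imp_less[of j k] by (auto simp: level_def)
  then show "attacking lam (i + 1, j) (i, k)"
    using assms by (auto simp: attacking_def level_def)
qed (use assms in \<open>auto simp: admissible_def dg_def level_def\<close>)

text \<open>Weak increase is given on rectangles and the entries of a row are distinct; the work is
  to see that \<open>level h\<close> spans a maximal block of columns of equal height.\<close>

lemma top_increasing:
  assumes "admissible \<tau>" "j \<in> level h" "k \<in> level h" "j < k"
  shows "\<tau> (h, j) < \<tau> (h, k)"
proof -
  define a where "a = Min (level h)"
  define b where "b = Max (level h)"
  have ne: "level h \<noteq> {}"
    using assms by auto
  then have a: "a \<in> level h" "\<And>i. i \<in> level h \<Longrightarrow> a \<le> i"
    and b: "b \<in> level h" "\<And>i. i \<in> level h \<Longrightarrow> i \<le> b"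
    by (auto simp: a_def b_def)
  have ab: "1 \<le> a" "b \<le> length lam" "a \<le> b"
    using a b by (auto simp: level_def)
  have mid: "ht lam i = h" if "a \<le> i" "i \<le> b" for i
    using ht_antimono[of a i] ht_antimono[of i b] that ab a(1) b(1) by (auto simp: level_def)
  have "a = 1 \<or> ht lam (a - 1) \<noteq> ht lam a"
  proof (rule ccontr)
    assume *: "\<not> ?thesis"
    then have "a - 1 \<in> level h"
      using a(1) by (auto simp: level_def)
    then show False
      using a(2) * ab(1) by fastforce
  qed
  moreover have "b = length lam \<or> ht lam (b + 1) \<noteq> ht lam b"
  proof (rule ccontr)
    assume *: "\<not> ?thesis"
    then have "b + 1 \<in> level h"
      using b(1) by (auto simp: level_def)
    then show False
      using b(2) by fastforce
  qed
  ultimately have "rectangle lam a b"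
    using ab mid by (auto simp: rectangle_def)
  then have "mono_on {a..b} (\<lambda>j. \<tau> (h, j))"
    using assms(1) mid ab by (auto simp: admissible_def top_row_increasing_def)
  then have "\<tau> (h, j) \<le> \<tau> (h, k)"
    using a(2) b(2) assms by (auto simp: mono_on_def)
  moreover have "\<tau> (h, j) \<noteq> \<tau> (h, k)"
    using admissible_row_neq[OF assms(1-3)] assms ht_pos[of j] by (auto simp: level_def)
  ultimately show ?thesis
    by simp
qed

section \<open>Quadruples at the bottom, at the top and inside a rectangle\<close>

definition inner :: "(nat \<times> nat \<times> nat) set" where
  "inner = {(r, j, k) \<in> quad_positions lam. 1 \<le> r \<and> r < ht lam j}"

definition top_positions :: "(nat \<times> nat \<times> nat) set" where
  "top_positions = {(r, j, k) \<in> quad_positions lam. r = ht lam j}"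

lemma finite_quad_positions: "finite (quad_positions lam)"
proof (rule finite_subset)
  show "quad_positions lam \<subseteq> {..Max (set lam)} \<times> {..length lam} \<times> {..length lam}"
  proof (rule subrelI)
    fix r p assume p: "(r, p) \<in> quad_positions lam"
    obtain j k where jk: "p = (j, k)"
      by (cases p)
    have "r \<le> ht lam j" "1 \<le> j" "j \<le> length lam" "k \<le> length lam"
      using p jk by (auto simp: quad_positions_def)
    then show "(r, p) \<in> {..Max (set lam)} \<times> {..length lam} \<times> {..length lam}"
      using ht_in_set[of j] Max_ge[of "set lam" "ht lam j"] jk by (auto intro: le_trans)
  qed
qed simp

lemma sum_quad_positions:
  assumes "\<And>j k. (0, j, k) \<in> quad_positions lam \<Longrightarrow> f (0, j, k) = (0::int)"
    and "\<And>r j k. (r, j, k) \<in> top_positions \<Longrightarrow> f (r, j, k) = 1"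
  shows "(\<Sum>p\<in>quad_positions lam. f p) = int (card top_positions) + (\<Sum>p\<in>inner. f p)"
proof -
  have fin: "finite top_positions" "finite inner"
    using finite_quad_positions
    by (auto simp: top_positions_def inner_def intro: rev_finite_subset)
  have "(\<Sum>p\<in>quad_positions lam. f p) = (\<Sum>p\<in>top_positions \<union> inner. f p)"
  proof (rule sum.mono_neutral_right[OF finite_quad_positions])
    show "\<forall>p\<in>quad_positions lam - (top_positions \<union> inner). f p = 0"
    proof
      fix p assume p: "p \<in> quad_positions lam - (top_positions \<union> inner)"
      obtain r j k where rjk: "p = (r, j, k)"
        by (cases p)
      then have "r = 0"
        using p by (auto simp: quad_positions_def top_positions_def inner_def)
      then show "f p = 0"
        using p rjk assms(1) by blast
    qed
  qed (auto simp: top_positions_def inner_def)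
  also have "\<dots> = (\<Sum>p\<in>top_positions. f p) + (\<Sum>p\<in>inner. f p)"
    using fin by (intro sum.union_disjoint) (auto simp: top_positions_def inner_def)
  also have "(\<Sum>p\<in>top_positions. f p) = (\<Sum>p\<in>top_positions. 1)"
    using assms(2) by (intro sum.cong) auto
  finally show ?thesis
    by simp
qed

definition at_box :: "filling \<Rightarrow> (nat \<Rightarrow> nat \<Rightarrow> nat \<Rightarrow> nat \<Rightarrow> 'b) \<Rightarrow> nat \<times> nat \<times> nat \<Rightarrow> 'b" where
  "at_box \<tau> f p = (case p of (r, j, k) \<Rightarrow> f (\<tau> (r + 1, j)) (\<tau> (r + 1, k)) (\<tau> (r, j)) (\<tau> (r, k)))"

lemma at_quad_inner: "p \<in> inner \<Longrightarrow>
  at_quad lam \<tau> f p = at_box \<tau> (\<lambda>z w u v. f (enat z) (enat w) (enat u) (enat v)) p"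
  by (auto simp: inner_def quad_positions_def at_quad_def at_box_def aug_def)

lemma inner_values:
  assumes "admissible \<tau>" "(r, j, k) \<in> inner"
  shows "\<tau> (r + 1, j) \<noteq> \<tau> (r + 1, k)" "\<tau> (r, j) \<noteq> \<tau> (r, k)"
    "\<tau> (r + 1, j) \<noteq> \<tau> (r, k)" "\<tau> (r + 1, k) \<noteq> \<tau> (r, j)"
proof -
  define h where "h = ht lam j"
  have *: "j \<in> level h" "k \<in> level h" "j \<noteq> k" "1 \<le> r" "r < h"
    using assms(2) by (auto simp: inner_def quad_positions_def level_def h_def)
  show "\<tau> (r + 1, j) \<noteq> \<tau> (r + 1, k)" "\<tau> (r, j) \<noteq> \<tau> (r, k)"
    using admissible_row_neq[OF assms(1) *(1-3)] * by auto
  show "\<tau> (r + 1, j) \<noteq> \<tau> (r, k)" "\<tau> (r + 1, k) \<noteq> \<tau> (r, j)"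
    using admissible_diag_neq[OF assms(1), of j h k h r] admissible_diag_neq[OF assms(1), of k h j h r] * by auto
qed

lemma
  assumes "admissible \<tau>" "(r, j, k) \<in> top_positions"
  shows top_values: "0 < \<tau> (r, j)" "\<tau> (r, j) < \<tau> (r, k)" "1 \<le> r"
    and at_quad_top: "at_quad lam \<tau> f (r, j, k) = f 0 0 (enat (\<tau> (r, j))) (enat (\<tau> (r, k)))"
proof -
  have *: "j \<in> level r" "k \<in> level r" "j < k" "0 < r"
    using assms(2) ht_pos[of j] by (auto simp: top_positions_def quad_positions_def level_def)
  show "0 < \<tau> (r, j)" "1 \<le> r"
    using admissible_pos[OF assms(1) *(1)] *(4) by auto
  show "\<tau> (r, j) < \<tau> (r, k)"
    using top_increasing[OF assms(1)] * by blast
  show "at_quad lam \<tau> f (r, j, k) = f 0 0 (enat (\<tau> (r, j))) (enat (\<tau> (r, k)))"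
    using * by (auto simp: at_quad_def aug_def level_def)
qed

lemma
  assumes "admissible \<tau>" "(0, j, k) \<in> quad_positions lam"
  shows bottom_values: "\<tau> (1, j) \<noteq> \<tau> (1, k)"
    and at_quad_bottom:
      "at_quad lam \<tau> f (0, j, k) = f (enat (\<tau> (1, j))) (enat (\<tau> (1, k))) \<infinity> \<infinity>"
proof -
  define h where "h = ht lam j"
  have *: "j \<in> level h" "k \<in> level h" "j \<noteq> k" "0 < h"
    using assms(2) ht_pos[of j] by (auto simp: quad_positions_def level_def h_def)
  show "\<tau> (1, j) \<noteq> \<tau> (1, k)"
    using admissible_row_neq[OF assms(1) *(1-3)] *(4) by auto
  show "at_quad lam \<tau> f (0, j, k) = f (enat (\<tau> (1, j))) (enat (\<tau> (1, k))) \<infinity> \<infinity>"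
    using * by (auto simp: at_quad_def aug_def level_def)
qed

lemma card_eq_sum: "finite A \<Longrightarrow> int (card {p \<in> A. P p}) = (\<Sum>p\<in>A. of_bool (P p))"
  by (simp add: Int_def)

text \<open>Above the entries \<infinity> of row 0 no quadruple counts, and above a strictly
  increasing top row every one does; what remains are pairs of genuine rows.\<close>

lemma quadcoinv_eq:
  assumes "admissible \<tau>"
  shows "int (quadcoinv lam \<tau>) =
    int (card top_positions) + (\<Sum>p\<in>inner. at_box \<tau> quadQ p) + int (uneven_triples lam \<tau>)"
proof -
  have "(\<Sum>p\<in>quad_positions lam. of_bool (at_quad lam \<tau> Q4 p = 1)) =
      int (card top_positions) + (\<Sum>p\<in>inner. of_bool (at_quad lam \<tau> Q4 p = 1))"
  proof (rule sum_quad_positions)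
    show "of_bool (at_quad lam \<tau> Q4 (0, j, k) = 1) = (0::int)"
      if p: "(0, j, k) \<in> quad_positions lam" for j k
      using Q4_bottom bottom_values[OF assms p] by (simp add: at_quad_bottom[OF assms p])
    show "of_bool (at_quad lam \<tau> Q4 (r, j, k) = 1) = (1::int)"
      if p: "(r, j, k) \<in> top_positions" for r j k
      using Q4_top top_values[OF assms p] by (simp add: at_quad_top[OF assms p])
  qed
  also have "(\<Sum>p\<in>inner. of_bool (at_quad lam \<tau> Q4 p = 1)) = (\<Sum>p\<in>inner. at_box \<tau> quadQ p)"
  proof (rule sum.cong[OF refl], clarify)
    fix r j k assume p: "(r, j, k) \<in> inner"
    have "of_bool (Q4 z w u v = 1) = int (Q4 z w u v)" for z w u v
      using Q4_01[of z w u v] by auto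
    then show "of_bool (at_quad lam \<tau> Q4 (r, j, k) = 1) = at_box \<tau> quadQ (r, j, k)"
      using Q4_enat inner_values[OF assms p] by (simp add: at_quad_inner[OF p] at_box_def)
  qed
  finally show ?thesis
    by (simp add: quadcoinv_def card_eq_sum finite_quad_positions del: sum_of_bool_eq)
qed

text \<open>At the top \<open>z = w = 0\<close>, so a quadruple not counted by \<open>eta\<close> is
  counted by \<open>alpha\<close>; at the bottom \<open>Q_sys\<close> vanishes and
  \<open>alpha\<close> is limited to \<open>r \<ge> 1\<close>. The constants thus agree with those
  in \<open>quadcoinv_eq\<close>.\<close>

lemma eta_alpha_eq:
  assumes "admissible \<tau>" "S \<in> ordering_systems"
  shows "int (eta S lam \<tau>) + int (alpha S lam \<tau>) =
    int (card top_positions) + (\<Sum>p\<in>inner. at_box \<tau> (quadS S) p) + int (uneven_triples lam \<tau>)"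
proof -
  define f :: "nat \<times> nat \<times> nat \<Rightarrow> int" where
    "f p = of_bool (at_quad lam \<tau> (Q_sys S) p = 1) + of_bool (fst p \<ge> 1 \<and> at_quad lam \<tau> (Q_sys S) p = 0 \<and>
        \<not> at_quad lam \<tau> (\<lambda>z w u v. distinct [z, w, u, v]) p)" for p
  have "(\<Sum>p\<in>quad_positions lam. f p) = int (card top_positions) + (\<Sum>p\<in>inner. f p)"
  proof (rule sum_quad_positions)
    show "f (0, j, k) = 0" if p: "(0, j, k) \<in> quad_positions lam" for j k
      using Q_sys_bottom[OF assms(2) bottom_values[OF assms(1) p]]
      by (simp add: f_def at_quad_bottom[OF assms(1) p])
    show "f (r, j, k) = 1" if p: "(r, j, k) \<in> top_positions" for r j k
      using Q_sys_01[of S 0 0 "enat (\<tau> (r, j))" "enat (\<tau> (r, k))"] top_values(3)[OF assms(1) p]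
      by (auto simp: f_def at_quad_top[OF assms(1) p])
  qed
  also have "(\<Sum>p\<in>inner. f p) = (\<Sum>p\<in>inner. at_box \<tau> (quadS S) p)"
  proof (rule sum.cong[OF refl], clarify)
    fix r j k assume p: "(r, j, k) \<in> inner"
    then have "1 \<le> r"
      by (auto simp: inner_def)
    then show "f (r, j, k) = at_box \<tau> (quadS S) (r, j, k)"
      using Q_sys_enat[OF inner_values[OF assms(1) p], of S]
      unfolding f_def at_quad_inner[OF p] by (simp add: at_box_def del: distinct.simps)
  qed
  finally show ?thesis
    by (simp add: eta_def alpha_def f_def card_eq_sum finite_quad_positions sum.distrib
        del: sum_of_bool_eq)
qed

section \<open>Invariants of the row contents and the descent numbers\<close>

definition row_descents :: "filling \<Rightarrow> nat \<Rightarrow> nat \<Rightarrow> int" where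
  "row_descents \<tau> h i = (\<Sum>j\<in>level h. of_bool (\<tau> (i, j) < \<tau> (i + 1, j)))"

text \<open>The common data behind \<open>maj\<close>, \<open>c_coeff\<close> and the triples
  between rectangles. Sets of entries suffice because an admissible filling is injective on each row
  of a rectangle.\<close>

definition similar :: "filling \<Rightarrow> filling \<Rightarrow> bool" where
  "similar \<tau> \<tau>' \<longleftrightarrow>
     (\<forall>h i. 1 \<le> i \<longrightarrow> i \<le> h \<longrightarrow> (\<lambda>j. \<tau>' (i, j)) ` level h = (\<lambda>j. \<tau> (i, j)) ` level h) \<and>
     (\<forall>h i. 1 \<le> i \<longrightarrow> i < h \<longrightarrow> row_descents \<tau>' h i = row_descents \<tau> h i)"

lemma similar_refl: "similar \<tau> \<tau>"
  by (simp add: similar_def)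

lemma similar_trans: "similar \<tau>1 \<tau>2 \<Longrightarrow> similar \<tau>2 \<tau>3 \<Longrightarrow> similar \<tau>1 \<tau>3"
  by (simp add: similar_def)

lemma similar_sum:
  assumes "admissible \<tau>" "admissible \<tau>'" "similar \<tau> \<tau>'" "1 \<le> i" "i \<le> h"
  shows "(\<Sum>j\<in>level h. f (\<tau>' (i, j))) = (\<Sum>j\<in>level h. f (\<tau> (i, j)))"
proof -
  have "(\<Sum>j\<in>level h. f (\<tau> (i, j))) = sum f ((\<lambda>j. \<tau> (i, j)) ` level h)" if "admissible \<tau>" for \<tau>
    using sum.reindex[OF admissible_inj[OF that assms(4,5)], of f] by (simp add: comp_def)
  then show ?thesis
    using assms by (simp add: similar_def)
qed

lemma maj_eq:
  "int (maj lam \<tau>) = (\<Sum>h\<in>set lam. \<Sum>i=1..h.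
     if i = 1 then 0 else int (h - i + 1) * row_descents \<tau> h (i - 1))"
proof -
  have "int (maj lam \<tau>) =
      (\<Sum>z\<in>dg lam. if fst z \<noteq> 1 \<and> \<tau> z > \<tau> (south z) then int (leg lam z + 1) else 0)"
    unfolding maj_def sum.inter_filter[OF finite_dg] of_nat_sum by (intro sum.cong) auto
  also have "\<dots> = (\<Sum>h\<in>set lam. \<Sum>i=1..h.
     if i = 1 then 0 else int (h - i + 1) * row_descents \<tau> h (i - 1))"
    unfolding sum_dg
  proof (intro sum.cong refl)
    fix h i :: nat assume i: "i \<in> {1..h}"
    show "(\<Sum>j\<in>level h. if fst (i, j) \<noteq> 1 \<and> \<tau> (i, j) > \<tau> (south (i, j)) then int (leg lam (i, j) + 1) else 0)
      = (if i = 1 then 0 else int (h - i + 1) * row_descents \<tau> h (i - 1))"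
    proof (cases "i = 1")
      case False
      have "(\<Sum>j\<in>level h. if fst (i, j) \<noteq> 1 \<and> \<tau> (i, j) > \<tau> (south (i, j)) then int (leg lam (i, j) + 1) else 0)
        = (\<Sum>j\<in>level h. int (h - i + 1) * of_bool (\<tau> (i - 1, j) < \<tau> (i - 1 + 1, j)))"
        using i False by (intro sum.cong) (auto simp: leg_eq south_def)
      then show ?thesis
        using False by (simp add: row_descents_def sum_distrib_left del: sum_of_bool_eq)
    qed simp
  qed
  finally show ?thesis .
qed

lemma maj_similar:
  assumes "similar \<tau> \<tau>'"
  shows "maj lam \<tau>' = maj lam \<tau>"
proof -
  have "int (maj lam \<tau>') = int (maj lam \<tau>)"
    unfolding maj_eq using assms by (intro sum.cong refl) (auto simp: similar_def)
  then show ?thesis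
    by simp
qed

section \<open>Triples between rectangles of different heights\<close>

definition triple_positions :: "(nat \<times> nat \<times> nat) set" where
  "triple_positions = {(r, j, k). 1 \<le> j \<and> j \<le> length lam \<and> 1 \<le> k \<and> k \<le> length lam \<and>
     ht lam k < ht lam j \<and> 1 \<le> r \<and> r \<le> ht lam k}"

text \<open>Grouping by the two heights and the row leaves a full product of two levels to sum over,
  which makes the additivity of \<open>Q\<close> usable.\<close>

definition triple_levels :: "(nat \<times> nat \<times> nat) set" where
  "triple_levels = (SIGMA h:set lam. SIGMA h':{h' \<in> set lam. h' < h}. {1..h'})"

lemma bij_triple_positions:
  "bij_betw (\<lambda>((h, h', r), j, k). (r, j, k))
     (SIGMA t:triple_levels. level (fst t) \<times> level (fst (snd t))) triple_positions"
  by (rule bij_betw_byWitness[where f' = "\<lambda>(r, j, k). ((ht lam j, ht lam k, r), j, k)"])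
    (auto simp: triple_levels_def triple_positions_def level_def ht_in_set)

definition triple_value :: "filling \<Rightarrow> nat \<times> nat \<times> nat \<Rightarrow> int" where
  "triple_value \<tau> p = (case p of (r, j, k) \<Rightarrow> Q (\<tau> (r + 1, j)) (\<tau> (r, j)) (\<tau> (r, k)))"

lemma Q3_triple:
  assumes "admissible \<tau>" "(r, j, k) \<in> triple_positions"
  shows "int (Q3 (aug lam \<tau> (r + 1) j) (aug lam \<tau> r j) (aug lam \<tau> r k)) = triple_value \<tau> (r, j, k)"
proof -
  define h h' where "h = ht lam j" and "h' = ht lam k"
  have *: "j \<in> level h" "k \<in> level h'" "j \<noteq> k" "1 \<le> r" "r < h" "r \<le> h'" "h' \<le> h"
    using assms(2) by (auto simp: triple_positions_def level_def h_def h'_def)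
  then have "\<tau> (r + 1, j) \<noteq> \<tau> (r, k)" "\<tau> (r, j) \<noteq> \<tau> (r, k)"
    using admissible_diag_neq[OF assms(1) *] admissible_row_neq[OF assms(1) *(1-4)] by auto
  then show ?thesis
    using * Q3_enat by (simp add: aug_def level_def triple_value_def)
qed

lemma uneven_triples_eq:
  assumes "admissible \<tau>"
  shows "int (uneven_triples lam \<tau>) = (\<Sum>(h, h', r)\<in>triple_levels.
    \<Sum>j\<in>level h. \<Sum>k\<in>level h'. Q (\<tau> (r + 1, j)) (\<tau> (r, j)) (\<tau> (r, k)))"
proof -
  have "finite triple_levels"
    by (auto simp: triple_levels_def)
  then have fin: "finite triple_positions"
    using bij_betw_finite[OF bij_triple_positions] by simp
  have "{(r, j, k). (r, j, k) \<in> queue_inversion_triples lam \<tau> \<and> ht lam j > ht lam k}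
      = {p \<in> triple_positions. triple_value \<tau> p = 1}"
  proof (intro set_eqI iffI; clarify)
    fix r j k assume *: "(r, j, k) \<in> queue_inversion_triples lam \<tau>" "ht lam j > ht lam k"
    then have jk: "1 \<le> j" "j < k" "k \<le> length lam" "r \<le> ht lam k + 1" "aug lam \<tau> r k \<noteq> 0"
      and Q3: "Q3 (aug lam \<tau> (r + 1) j) (aug lam \<tau> r j) (aug lam \<tau> r k) = 1"
      by (auto simp: queue_inversion_triples_def)
    \<comment> \<open>In row 0 both \<open>b\<close> and \<open>c\<close> are \<infinity>, and then
      two of the three conditions in \<open>Q3\<close> hold.\<close>
    have "r \<noteq> 0"
    proof
      assume "r = 0"
      then show False
        using Q3 *(2) by (auto simp: aug_def Q3_def I_ind_def split: if_splits)
    qed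
    moreover have "r \<noteq> ht lam k + 1"
      using jk(5) by (auto simp: aug_def)
    ultimately have p: "(r, j, k) \<in> triple_positions"
      using jk *(2) by (auto simp: triple_positions_def)
    then show "(r, j, k) \<in> triple_positions \<and> triple_value \<tau> (r, j, k) = 1"
      using Q3 Q3_triple[OF assms p] by simp
  next
    fix r j k assume *: "(r, j, k) \<in> triple_positions" "triple_value \<tau> (r, j, k) = 1"
    then have r: "1 \<le> j" "j \<le> length lam" "1 \<le> k" "k \<le> length lam" "ht lam k < ht lam j"
      "1 \<le> r" "r \<le> ht lam k"
      by (auto simp: triple_positions_def)
    have "0 < \<tau> (r, k)"
      using r admissible_pos[OF assms, of k "ht lam k" r] by (simp add: level_def)
    then have "aug lam \<tau> r k \<noteq> 0"
      using r by (simp add: aug_def zero_enat_def)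
    moreover have "Q3 (aug lam \<tau> (r + 1) j) (aug lam \<tau> r j) (aug lam \<tau> r k) = 1"
      using Q3_triple[OF assms *(1)] *(2) by simp
    ultimately show "(r, j, k) \<in> queue_inversion_triples lam \<tau> \<and> ht lam k < ht lam j"
      using r taller_imp_less[of j k] by (simp add: queue_inversion_triples_def)
  qed
  then have "int (uneven_triples lam \<tau>) = (\<Sum>p\<in>triple_positions. of_bool (triple_value \<tau> p = 1))"
    unfolding uneven_triples_def using fin by (simp add: card_eq_sum del: sum_of_bool_eq)
  also have "\<dots> = (\<Sum>p\<in>triple_positions. triple_value \<tau> p)"
  proof (rule sum.cong[OF refl], clarify)
    fix r j k assume p: "(r, j, k) \<in> triple_positions"
    have "of_bool (int (Q3 a b c) = 1) = int (Q3 a b c)" for a b c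
      by (simp add: Q3_def)
    then show "of_bool (triple_value \<tau> (r, j, k) = 1) = triple_value \<tau> (r, j, k)"
      unfolding Q3_triple[OF assms p, symmetric] by blast
  qed
  also have "\<dots> = (\<Sum>(h, h', r)\<in>triple_levels.
    \<Sum>j\<in>level h. \<Sum>k\<in>level h'. Q (\<tau> (r + 1, j)) (\<tau> (r, j)) (\<tau> (r, k)))"
  proof -
    let ?F = "\<lambda>t p. Q (\<tau> (snd (snd t) + 1, fst p)) (\<tau> (snd (snd t), fst p)) (\<tau> (snd (snd t), snd p))"
    have "(\<Sum>p\<in>triple_positions. triple_value \<tau> p) =
        (\<Sum>(t, p)\<in>(SIGMA t:triple_levels. level (fst t) \<times> level (fst (snd t))). ?F t p)"
      unfolding sum.reindex_bij_betw[OF bij_triple_positions, symmetric]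
      by (simp add: triple_value_def case_prod_unfold)
    also have "\<dots> = (\<Sum>t\<in>triple_levels. \<Sum>p\<in>level (fst t) \<times> level (fst (snd t)). ?F t p)"
      using \<open>finite triple_levels\<close> by (intro sum.Sigma[symmetric]) auto
    finally show ?thesis
      by (simp add: sum.cartesian_product case_prod_unfold)
  qed
  finally show ?thesis .
qed

text \<open>Summed over a pair of levels, the first two terms of \<open>Q\<close> depend only on the
  sets of entries of the rows involved, and the third one only on the number of descents.\<close>

lemma uneven_triples_similar:
  assumes "admissible \<tau>" "admissible \<tau>'" "similar \<tau> \<tau>'"
  shows "uneven_triples lam \<tau>' = uneven_triples lam \<tau>"
proof -
  have split: "(\<Sum>j\<in>level h. \<Sum>k\<in>level h'. Q (\<tau> (r + 1, j)) (\<tau> (r, j)) (\<tau> (r, k))) =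
      (\<Sum>j\<in>level h. \<Sum>k\<in>level h'. of_bool (\<tau> (r, k) < \<tau> (r + 1, j))) -
      (\<Sum>j\<in>level h. \<Sum>k\<in>level h'. of_bool (\<tau> (r, k) < \<tau> (r, j))) +
      int (card (level h')) * (int (card (level h)) - row_descents \<tau> h r)" for \<tau> h h' r
  proof -
    have "Q a b c = of_bool (c < a) - of_bool (c < b) + (1 - of_bool (b < a))" for a b c
      by (simp add: Q_def)
    then show ?thesis
      by (simp add: sum.distrib sum_subtractf row_descents_def sum_distrib_left[symmetric]
          del: sum_of_bool_eq)
  qed
  have "int (uneven_triples lam \<tau>') = int (uneven_triples lam \<tau>)"
    unfolding uneven_triples_eq[OF assms(1)] uneven_triples_eq[OF assms(2)]
  proof (rule sum.cong[OF refl], clarify)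
    fix h h' r assume "(h, h', r) \<in> triple_levels"
    then have r: "1 \<le> r" "r \<le> h'" "r < h" "r \<le> h" "r + 1 \<le> h" "1 \<le> r + 1"
      by (auto simp: triple_levels_def)
    note sum_eq = similar_sum[OF assms]
    have 1: "(\<Sum>k\<in>level h'. of_bool (\<tau>' (r, k) < x)) = (\<Sum>k\<in>level h'. of_bool (\<tau> (r, k) < x) :: int)"
      for x
      using sum_eq[OF r(1,2), of "\<lambda>y. of_bool (y < x)"] .
    have 2: "(\<Sum>j\<in>level h. \<Sum>k\<in>level h'. of_bool (\<tau>' (r, k) < \<tau>' (i, j))) =
      (\<Sum>j\<in>level h. \<Sum>k\<in>level h'. of_bool (\<tau> (r, k) < \<tau> (i, j)) :: int)" if "1 \<le> i" "i \<le> h" for i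
      unfolding 1 using sum_eq[OF that, of "\<lambda>x. \<Sum>k\<in>level h'. of_bool (\<tau> (r, k) < x)"] .
    have "row_descents \<tau>' h r = row_descents \<tau> h r"
      using assms(3) r by (simp add: similar_def)
    then show "(\<Sum>j\<in>level h. \<Sum>k\<in>level h'. Q (\<tau>' (r + 1, j)) (\<tau>' (r, j)) (\<tau>' (r, k))) =
        (\<Sum>j\<in>level h. \<Sum>k\<in>level h'. Q (\<tau> (r + 1, j)) (\<tau> (r, j)) (\<tau> (r, k)))"
      unfolding split using 2[OF r(1,4)] 2[OF r(6,5)] by simp
  qed
  then show ?thesis
    by simp
qed

section \<open>Unrestricted boxes and the coefficient c\<close>

definition unrestricted :: "filling \<Rightarrow> nat \<Rightarrow> nat \<Rightarrow> nat set" where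
  "unrestricted \<tau> h i = {j \<in> level h. \<tau> (i, j) \<noteq> \<tau> (i - 1, j)}"

text \<open>By the diagonal condition a value common to both rows sits in a single column, so the
  restricted columns correspond to the common values.\<close>

lemma card_unrestricted:
  assumes "admissible \<tau>" "2 \<le> i" "i \<le> h"
  shows "card (unrestricted \<tau> h i) =
    card (level h) - card ((\<lambda>j. \<tau> (i, j)) ` level h \<inter> (\<lambda>j. \<tau> (i - 1, j)) ` level h)"
proof -
  define R where "R = {j \<in> level h. \<tau> (i, j) = \<tau> (i - 1, j)}"
  have "(\<lambda>j. \<tau> (i, j)) ` level h \<inter> (\<lambda>j. \<tau> (i - 1, j)) ` level h = (\<lambda>j. \<tau> (i, j)) ` R"
  proof (intro equalityI subsetI)
    fix x assume "x \<in> (\<lambda>j. \<tau> (i, j)) ` level h \<inter> (\<lambda>j. \<tau> (i - 1, j)) ` level h"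
    then obtain j k where jk: "j \<in> level h" "k \<in> level h" "x = \<tau> (i, j)" "x = \<tau> (i - 1, k)"
      by auto
    have "1 \<le> i - 1" "i - 1 < h" "i - 1 \<le> h" "i - 1 + 1 = i"
      using assms(2,3) by auto
    then have "j = k"
      using admissible_diag_neq[OF assms(1) jk(1,2), of "i - 1"] jk(3,4) by auto
    then show "x \<in> (\<lambda>j. \<tau> (i, j)) ` R"
      using jk by (intro image_eqI[of _ _ j]) (auto simp: R_def)
  next
    fix x assume "x \<in> (\<lambda>j. \<tau> (i, j)) ` R"
    then obtain j where "j \<in> level h" "x = \<tau> (i, j)" "x = \<tau> (i - 1, j)"
      by (auto simp: R_def)
    then show "x \<in> (\<lambda>j. \<tau> (i, j)) ` level h \<inter> (\<lambda>j. \<tau> (i - 1, j)) ` level h"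
      by blast
  qed
  moreover have "inj_on (\<lambda>j. \<tau> (i, j)) R"
    using admissible_inj[OF assms(1), of i h] assms(2,3)
    by (auto simp: R_def intro: inj_on_subset)
  moreover have "unrestricted \<tau> h i = level h - R" "R \<subseteq> level h"
    by (auto simp: unrestricted_def R_def)
  ultimately show ?thesis
    by (simp add: card_image card_Diff_subset finite_subset[of R "level h"])
qed

text \<open>In a row of a rectangle the leg is constant, and the arm of an unrestricted box is a
  constant plus its rank among the unrestricted boxes. So the product depends only on how many of
  these there are.\<close>

lemma c_coeff_eq:
  "c_coeff lam \<tau> = (\<Prod>h\<in>set lam. \<Prod>i=1..h. if i = 1 then 1 else
     \<Prod>m<card (unrestricted \<tau> h i). (1 - t_var) / (1 - q_var ^ (h - i + 1) *
       t_var ^ (card {k. (i - 1, k) \<in> dg lam \<and> ht lam k < h} + m + 1)))"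
proof -
  define f where "f u = (1 - t_var) / (1 - q_var ^ (leg lam u + 1) * t_var ^ (arm_bar lam \<tau> u + 1))" for u
  have "c_coeff lam \<tau> = (\<Prod>u\<in>dg lam. if fst u \<noteq> 1 \<and> \<tau> u \<noteq> \<tau> (south u) then f u else 1)"
    unfolding c_coeff_def prod.inter_filter[OF finite_dg] f_def ..
  also have "\<dots> = (\<Prod>h\<in>set lam. \<Prod>i=1..h. if i = 1 then 1 else
     \<Prod>m<card (unrestricted \<tau> h i). (1 - t_var) / (1 - q_var ^ (h - i + 1) *
       t_var ^ (card {k. (i - 1, k) \<in> dg lam \<and> ht lam k < h} + m + 1)))"
    unfolding prod_dg
  proof (intro prod.cong refl)
    fix h i :: nat assume i: "i \<in> {1..h}"
    let ?U = "unrestricted \<tau> h i"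
    let ?K = "card {k. (i - 1, k) \<in> dg lam \<and> ht lam k < h}"
    let ?g = "\<lambda>m. (1 - t_var) / (1 - q_var ^ (h - i + 1) * t_var ^ (?K + m + 1))"
    show "(\<Prod>j\<in>level h. if fst (i, j) \<noteq> 1 \<and> \<tau> (i, j) \<noteq> \<tau> (south (i, j)) then f (i, j) else 1) =
      (if i = 1 then 1 else \<Prod>m<card ?U. ?g m)"
    proof (cases "i = 1")
      case False
      have arm: "arm_bar lam \<tau> (i, j) = ?K + card {k \<in> ?U. k < j}" if j: "j \<in> level h" for j
      proof -
        have "{k. (i - 1, k) \<in> dg lam \<and> k > j \<and> ht lam k < ht lam j} =
            {k. (i - 1, k) \<in> dg lam \<and> ht lam k < h}"
          using j taller_imp_less[of j] by (auto simp: level_def dg_def)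
        moreover have "{k. (i, k) \<in> dg lam \<and> k < j \<and> ht lam k = ht lam j \<and> \<not> restricted \<tau> (i, k)} =
            {k \<in> ?U. k < j}"
          using j i False by (auto simp: level_def dg_def restricted_def south_def unrestricted_def)
        ultimately show ?thesis
          by (simp add: arm_bar_def)
      qed
      have "(\<Prod>j\<in>level h. if fst (i, j) \<noteq> 1 \<and> \<tau> (i, j) \<noteq> \<tau> (south (i, j)) then f (i, j) else 1) =
          (\<Prod>j\<in>?U. f (i, j))"
        unfolding unrestricted_def prod.inter_filter[OF finite_level]
        using False by (simp add: south_def)
      also have "\<dots> = (\<Prod>j\<in>?U. ?g (card {k \<in> ?U. k < j}))"
      proof (intro prod.cong refl)
        fix j assume "j \<in> ?U"
        then have j: "j \<in> level h"
          by (simp add: unrestricted_def)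
        show "f (i, j) = ?g (card {k \<in> ?U. k < j})"
          using i leg_eq[OF j, of i] by (simp add: f_def arm[OF j])
      qed
      also have "\<dots> = (\<Prod>m<card ?U. ?g m)"
        by (rule prod_rank) (simp add: unrestricted_def)
      finally show ?thesis
        using False by simp
    qed simp
  qed
  finally show ?thesis .
qed

lemma c_coeff_similar:
  assumes "admissible \<tau>" "admissible \<tau>'" "similar \<tau> \<tau>'"
  shows "c_coeff lam \<tau>' = c_coeff lam \<tau>"
proof -
  have "card (unrestricted \<tau>' h i) = card (unrestricted \<tau> h i)" if "2 \<le> i" "i \<le> h" for h i
    using card_unrestricted[OF assms(1) that] card_unrestricted[OF assms(2) that] assms(3) that
    by (simp add: similar_def)
  then show ?thesis
    unfolding c_coeff_eq by (intro prod.cong refl) auto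
qed

section \<open>Permuting the columns of the lower rows\<close>

text \<open>Rows 1 to \<open>r\<close> of the rectangle are permuted as a block, so each entry of
  row \<open>r\<close> keeps everything below it. Fillings are changed by composition with this
  map.\<close>

definition col_map :: "nat \<Rightarrow> nat \<Rightarrow> (nat \<Rightarrow> nat) \<Rightarrow> box \<Rightarrow> box" where
  "col_map h r \<pi> u = (if snd u \<in> level h \<and> 1 \<le> fst u \<and> fst u \<le> r then (fst u, \<pi> (snd u)) else u)"

lemma fst_col_map [simp]: "fst (col_map h r \<pi> u) = fst u"
  by (simp add: col_map_def)

lemma snd_col_map_level:
  assumes "bij_betw \<pi> (level h) (level h)" "j \<in> level h'"
  shows "snd (col_map h r \<pi> (i, j)) \<in> level h'"
proof (cases "j \<in> level h")
  case True
  then have "h' = h"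
    using assms(2) by (auto simp: level_def)
  then show ?thesis
    using bij_betwE[OF assms(1)] True by (auto simp: col_map_def)
qed (use assms(2) in \<open>simp add: col_map_def\<close>)

lemma col_map_dg:
  assumes \<pi>: "bij_betw \<pi> (level h) (level h)" and r: "r < h"
  shows "col_map h r \<pi> u \<in> dg lam \<longleftrightarrow> u \<in> dg lam"
proof (cases "snd u \<in> level h \<and> 1 \<le> fst u \<and> fst u \<le> r")
  case True
  then have "\<pi> (snd u) \<in> level h"
    using bij_betwE[OF \<pi>] by blast
  then show ?thesis
    using True r by (cases u) (auto simp: col_map_def dg_def level_def)
next
  case False
  then have "col_map h r \<pi> u = u"
    unfolding col_map_def by (rule if_not_P)
  then show ?thesis
    by simp
qed

lemma col_map_inj:
  assumes \<pi>: "bij_betw \<pi> (level h) (level h)"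
  shows "inj (col_map h r \<pi>)"
proof (rule injI)
  fix u v assume *: "col_map h r \<pi> u = col_map h r \<pi> v"
  then have f: "fst u = fst v"
    by (metis fst_col_map)
  \<comment> \<open>Membership in the rectangle can be read off the image, which excludes that only
    one of the two boxes is in the moved block.\<close>
  have level: "snd (col_map h r \<pi> x) \<in> level h \<longleftrightarrow> snd x \<in> level h" for x
    using bij_betwE[OF \<pi>] by (auto simp: col_map_def)
  show "u = v"
  proof (cases "snd u \<in> level h \<and> 1 \<le> fst u \<and> fst u \<le> r")
    case True
    then have v: "snd v \<in> level h"
      using level[of u] level[of v] * by simp
    then have "\<pi> (snd u) = \<pi> (snd v)"
      using True * f by (simp add: col_map_def)
    then have "snd u = snd v"
      using \<pi> True v by (auto simp: bij_betw_def inj_on_def)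
    then show ?thesis
      using f by (simp add: prod_eq_iff)
  next
    case False
    then have "\<not> (snd v \<in> level h \<and> 1 \<le> fst v \<and> fst v \<le> r)"
      using level[of u] level[of v] * f by simp
    then have "col_map h r \<pi> u = u" "col_map h r \<pi> v = v"
      using False unfolding col_map_def by (simp_all only: if_False)
    then show ?thesis
      using * by metis
  qed
qed

lemma row_equivalent_col_map:
  assumes \<pi>: "bij_betw \<pi> (level h) (level h)" and r: "r < h"
  shows "row_equivalent lam \<tau> (\<tau> \<circ> col_map h r \<pi>)"
  unfolding row_equivalent_def row_content_def
proof
  fix i
  let ?A = "{u \<in> dg lam. fst u = i}"
  have fin: "finite ?A"
    using finite_dg by simp
  have inj: "inj_on (col_map h r \<pi>) ?A"
    using col_map_inj[OF \<pi>] by (rule inj_on_subset) simp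
  have "col_map h r \<pi> ` ?A \<subseteq> ?A"
    using col_map_dg[OF assms] by auto
  then have "col_map h r \<pi> ` ?A = ?A"
    using endo_inj_surj[OF fin _ inj] by blast
  then have "image_mset (col_map h r \<pi>) (mset_set ?A) = mset_set ?A"
    using image_mset_mset_set[OF inj] by simp
  then show "image_mset \<tau> (mset_set ?A) = image_mset (\<tau> \<circ> col_map h r \<pi>) (mset_set ?A)"
    by (metis multiset.map_comp)
qed

text \<open>New attacks can only arise between rows \<open>r\<close> and \<open>r + 1\<close> of the
  rectangle, which \<open>cross\<close> excludes; the top row stays in place because
  \<open>r < h\<close>.\<close>

lemma admissible_col_map:
  assumes \<tau>: "admissible \<tau>" and \<pi>: "bij_betw \<pi> (level h) (level h)" and r: "r < h"
    and cross: "\<And>j k. j \<in> level h \<Longrightarrow> k \<in> level h \<Longrightarrow> \<tau> (r + 1, j) = \<tau> (r, \<pi> k) \<Longrightarrow> j = k"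
  shows "admissible (\<tau> \<circ> col_map h r \<pi>)"
proof -
  let ?\<rho> = "\<lambda>i j. snd (col_map h r \<pi> (i, j))"
  have \<rho>: "(\<tau> \<circ> col_map h r \<pi>) (i, j) = \<tau> (i, ?\<rho> i j)" for i j
    by (simp add: col_map_def)
  have \<rho>_inj: "?\<rho> i j \<noteq> ?\<rho> i k" if "j \<noteq> k" for i j k
    using injD[OF col_map_inj[OF \<pi>, of r], of "(i, j)" "(i, k)"] that
    by (auto simp: prod_eq_iff)
  note \<rho>_level = snd_col_map_level[OF \<pi>]
  have row: "\<tau> (i, ?\<rho> i j) \<noteq> \<tau> (i, ?\<rho> i k)"
    if "j \<in> level l" "k \<in> level l'" "j \<noteq> k" "1 \<le> i" "i \<le> l" "i \<le> l'" for i j k l l'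
    using admissible_row_neq[OF \<tau> \<rho>_level[OF that(1)] \<rho>_level[OF that(2)] \<rho>_inj[OF that(3)]] that by blast
  have diag: "\<tau> (i + 1, ?\<rho> (i + 1) j) \<noteq> \<tau> (i, ?\<rho> i k)"
    if jk: "j \<in> level l" "k \<in> level l'" "j \<noteq> k" "1 \<le> i" "i < l" "i \<le> l'" "l' \<le> l" for i j k l l'
  proof (cases "i = r \<and> j \<in> level h \<and> k \<in> level h")
    case True
    then have "?\<rho> (i + 1) j = j" "?\<rho> i k = \<pi> k"
      using jk by (auto simp: col_map_def)
    then show ?thesis
      using cross[of j k] True jk(3) by auto
  next
    case False
    \<comment> \<open>Elsewhere two adjacent rows of a rectangle are permuted alike or not at all,
      and columns of different rectangles are never mixed.\<close>
    have "?\<rho> (i + 1) j \<noteq> ?\<rho> i k"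
    proof (cases "l = l'")
      case True
      then have "j \<in> level h \<longleftrightarrow> k \<in> level h"
        using jk by (simp add: level_def)
      then consider "j \<in> level h" "k \<in> level h" "i < r" | "j \<in> level h" "k \<in> level h" "r < i" |
        "j \<notin> level h" "k \<notin> level h"
        using False by (cases i r rule: linorder_cases) blast+
      then show ?thesis
      proof cases
        case 1
        then have "?\<rho> (i + 1) j = ?\<rho> i j"
          using jk by (auto simp: col_map_def)
        then show ?thesis
          using \<rho>_inj[OF jk(3)] by simp
      qed (use jk in \<open>auto simp: col_map_def\<close>)
    next
      case False
      then show ?thesis
        using \<rho>_level[OF jk(1), of r "i + 1"] \<rho>_level[OF jk(2), of r i] by (auto simp: level_def)
    qed
    then show ?thesis
      using admissible_diag_neq[OF \<tau> \<rho>_level[OF jk(1)] \<rho>_level[OF jk(2)]] jk by blast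
  qed
  have "(\<tau> \<circ> col_map h r \<pi>) u = undefined" if "u \<notin> dg lam" for u
  proof -
    have "col_map h r \<pi> u \<notin> dg lam"
      using that col_map_dg[OF \<pi> r] by simp
    moreover have "\<tau> \<in> dg lam \<rightarrow>\<^sub>E {0<..}"
      using \<tau> by (simp add: admissible_def positive_fillings_def)
    ultimately show ?thesis
      unfolding comp_apply by (rule PiE_arb[rotated])
  qed
  moreover have "(\<tau> \<circ> col_map h r \<pi>) u \<in> {0<..}" if "u \<in> dg lam" for u
  proof -
    have "col_map h r \<pi> u \<in> dg lam"
      using that col_map_dg[OF \<pi> r] by simp
    moreover have "\<tau> \<in> dg lam \<rightarrow>\<^sub>E {0<..}"
      using \<tau> by (simp add: admissible_def positive_fillings_def)
    ultimately show ?thesis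
      unfolding comp_apply by (rule PiE_mem[rotated])
  qed
  ultimately have "\<tau> \<circ> col_map h r \<pi> \<in> positive_fillings lam"
    unfolding positive_fillings_def by (rule PiE_I[rotated])
  moreover have "non_attacking lam (\<tau> \<circ> col_map h r \<pi>)"
    unfolding non_attacking_def
  proof clarify
    fix i j i' k
    assume box: "(i, j) \<in> dg lam" "(i', k) \<in> dg lam"
      and eq: "(\<tau> \<circ> col_map h r \<pi>) (i, j) = (\<tau> \<circ> col_map h r \<pi>) (i', k)"
      and att: "attacking lam (i, j) (i', k)"
    define l l' where "l = ht lam j" and "l' = ht lam k"
    have lev: "j \<in> level l" "k \<in> level l'" "1 \<le> i" "i \<le> l" "1 \<le> i'" "i' \<le> l'"
      using box by (auto simp: dg_def level_def l_def l'_def)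
    have "j \<noteq> k"
      using att by (auto simp: attacking_def)
    consider "i = i'" | "i = i' + 1" "l' \<le> l"
      using att box ht_antimono[of j k] by (auto simp: attacking_def dg_def l_def l'_def)
    then show False
    proof cases
      case 1
      then show False
        using row[OF lev(1,2) \<open>j \<noteq> k\<close>, of i] lev eq unfolding \<rho> by blast
    next
      case 2
      then show False
        using diag[OF lev(1,2) \<open>j \<noteq> k\<close>, of i'] lev eq unfolding \<rho> by auto
    qed
  qed
  moreover have "top_row_increasing lam (\<tau> \<circ> col_map h r \<pi>)"
    unfolding top_row_increasing_def
  proof (intro allI impI)
    fix a b assume ab: "rectangle lam a b"
    then have "mono_on {a..b} (\<lambda>j. \<tau> (ht lam a, j))"
      using \<tau> by (simp add: admissible_def top_row_increasing_def)
    moreover have "(\<tau> \<circ> col_map h r \<pi>) (ht lam a, j) = \<tau> (ht lam a, j)" if "j \<in> {a..b}" for j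
    proof -
      have "ht lam j = ht lam a"
        using ab that unfolding rectangle_def by blast
      then have "\<not> (j \<in> level h \<and> ht lam a \<le> r)"
        using r by (auto simp: level_def)
      then show ?thesis
        by (auto simp: col_map_def)
    qed
    ultimately show "mono_on {a..b} (\<lambda>j. (\<tau> \<circ> col_map h r \<pi>) (ht lam a, j))"
      by (simp add: mono_on_def)
  qed
  ultimately show ?thesis
    by (simp add: admissible_def)
qed

text \<open>Descents inside the moved block are only reindexed and those above it stay the same; the
  hypothesis \<open>desc\<close> concerns the boundary between rows \<open>r\<close> and
  \<open>r + 1\<close>.\<close>

lemma similar_col_map:
  assumes \<pi>: "bij_betw \<pi> (level h) (level h)"
    and desc: "row_descents (\<tau> \<circ> col_map h r \<pi>) h r = row_descents \<tau> h r"
  shows "similar \<tau> (\<tau> \<circ> col_map h r \<pi>)"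
  unfolding similar_def
proof (intro conjI allI impI)
  fix l i :: nat
  have *: "(\<lambda>j. (\<tau> \<circ> col_map h r \<pi>) (i, j)) ` level h = (\<lambda>j. \<tau> (i, j)) ` level h"
  proof (cases "1 \<le> i \<and> i \<le> r")
    case True
    then have "(\<lambda>j. (\<tau> \<circ> col_map h r \<pi>) (i, j)) ` level h = (\<lambda>j. \<tau> (i, \<pi> j)) ` level h"
      by (intro image_cong) (auto simp: col_map_def)
    also have "\<dots> = (\<lambda>j. \<tau> (i, j)) ` \<pi> ` level h"
      by (simp add: image_image)
    finally show ?thesis
      using \<pi> by (simp add: bij_betw_def)
  qed (auto simp: col_map_def)
  show "(\<lambda>j. (\<tau> \<circ> col_map h r \<pi>) (i, j)) ` level l = (\<lambda>j. \<tau> (i, j)) ` level l"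
  proof (cases "l = h")
    case False
    then show ?thesis
      by (intro image_cong) (auto simp: col_map_def level_def)
  qed (simp only: *)
next
  fix l i :: nat assume i: "1 \<le> i" "i < l"
  show "row_descents (\<tau> \<circ> col_map h r \<pi>) l i = row_descents \<tau> l i"
  proof (cases "l = h")
    case False
    then show ?thesis
      unfolding row_descents_def by (intro sum.cong) (auto simp: col_map_def level_def)
  next
    case True
    consider "i < r" | "i = r" | "r < i"
      by linarith
    then show ?thesis
    proof cases
      case 1
      then have "row_descents (\<tau> \<circ> col_map h r \<pi>) h i =
          (\<Sum>j\<in>level h. of_bool (\<tau> (i, \<pi> j) < \<tau> (i + 1, \<pi> j)))"
        unfolding row_descents_def using i by (intro sum.cong) (auto simp: col_map_def)
      also have "\<dots> = row_descents \<tau> h i"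
        unfolding row_descents_def
        by (rule sum.reindex_bij_betw[OF \<pi>, of "\<lambda>j. of_bool (\<tau> (i, j) < \<tau> (i + 1, j))"])
      finally show ?thesis
        using True by simp
    next
      case 2
      then show ?thesis
        using True desc by simp
    next
      case 3
      then show ?thesis
        unfolding row_descents_def by (intro sum.cong) (auto simp: col_map_def)
    qed
  qed
qed

section \<open>Sums over one pair of adjacent rows of a rectangle\<close>

definition gap_sum ::
  "(nat \<Rightarrow> nat \<Rightarrow> nat \<Rightarrow> nat \<Rightarrow> int) \<Rightarrow> filling \<Rightarrow> nat \<Rightarrow> nat \<Rightarrow> int" where
  "gap_sum F \<tau> h r = psum (\<lambda>j k. F (\<tau> (r + 1, j)) (\<tau> (r + 1, k)) (\<tau> (r, j)) (\<tau> (r, k)))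
     (sorted_list_of_set (level h))"

lemma sum_inner:
  "(\<Sum>p\<in>inner. at_box \<tau> F p) = (\<Sum>h\<in>set lam. \<Sum>r\<in>{1..<h}. gap_sum F \<tau> h r)"
proof -
  have bij: "bij_betw (\<lambda>((h, r), j, k). (r, j, k))
    (SIGMA t:(SIGMA h:set lam. {1..<h}). SIGMA j:level (fst t). {k \<in> level (fst t). j < k}) inner"
    by (rule bij_betw_byWitness[where f' = "\<lambda>(r, j, k). ((ht lam j, r), j, k)"])
      (auto simp: inner_def quad_positions_def level_def ht_in_set)
  let ?F = "\<lambda>t p. F (\<tau> (snd t + 1, fst p)) (\<tau> (snd t + 1, snd p)) (\<tau> (snd t, fst p)) (\<tau> (snd t, snd p))"
  have "(\<Sum>p\<in>inner. at_box \<tau> F p) =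
      (\<Sum>(t, p)\<in>(SIGMA t:(SIGMA h:set lam. {1..<h}). SIGMA j:level (fst t). {k \<in> level (fst t). j < k}).
        ?F t p)"
    unfolding sum.reindex_bij_betw[OF bij, symmetric]
    by (simp add: at_box_def case_prod_unfold)
  also have "\<dots> = (\<Sum>t\<in>(SIGMA h:set lam. {1..<h}).
      \<Sum>p\<in>(SIGMA j:level (fst t). {k \<in> level (fst t). j < k}). ?F t p)"
    by (intro sum.Sigma[symmetric]) auto
  also have "\<dots> = (\<Sum>t\<in>(SIGMA h:set lam. {1..<h}). gap_sum F \<tau> (fst t) (snd t))"
  proof (rule sum.cong[OF refl])
    fix t
    have "(\<Sum>p\<in>(SIGMA j:level (fst t). {k \<in> level (fst t). j < k}). ?F t p) =
        (\<Sum>j\<in>level (fst t). \<Sum>k | k \<in> level (fst t) \<and> j < k. ?F t (j, k))"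
      by (subst sum.Sigma) (auto simp: case_prod_unfold)
    then show "(\<Sum>p\<in>(SIGMA j:level (fst t). {k \<in> level (fst t). j < k}). ?F t p) =
        gap_sum F \<tau> (fst t) (snd t)"
      by (simp add: gap_sum_def psum_sorted)
  qed
  also have "\<dots> = (\<Sum>h\<in>set lam. \<Sum>r\<in>{1..<h}. gap_sum F \<tau> h r)"
    by (subst sum.Sigma) (auto simp: case_prod_unfold)
  finally show ?thesis .
qed

lemma gap_sum_col_map_other:
  assumes "h' \<noteq> h \<or> r < r'"
  shows "gap_sum F (\<tau> \<circ> col_map h r \<pi>) h' r' = gap_sum F \<tau> h' r'"
  unfolding gap_sum_def
proof (rule psum_cong)
  fix j k assume "j \<in> set (sorted_list_of_set (level h'))" "k \<in> set (sorted_list_of_set (level h'))"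
  then have "col_map h r \<pi> (i, j) = (i, j) \<and> col_map h r \<pi> (i, k) = (i, k)" if "r' \<le> i" for i
    using assms that by (auto simp: col_map_def level_def)
  then show "F ((\<tau> \<circ> col_map h r \<pi>) (r' + 1, j)) ((\<tau> \<circ> col_map h r \<pi>) (r' + 1, k))
        ((\<tau> \<circ> col_map h r \<pi>) (r', j)) ((\<tau> \<circ> col_map h r \<pi>) (r', k)) =
      F (\<tau> (r' + 1, j)) (\<tau> (r' + 1, k)) (\<tau> (r', j)) (\<tau> (r', k))"
    by simp
qed simp

lemma quadS_commute:
  assumes "S \<in> ordering_systems" "z \<noteq> w"
  shows "quadS S z w u v = quadS S w z v u"
proof -
  have "Q_sys S (enat z) (enat w) (enat u) (enat v) = Q_sys S (enat w) (enat z) (enat v) (enat u)"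
    using Q_sys_neq[OF assms(1), of "enat z" "enat w"] Q_sys_neq[OF assms(1), of "enat w" "enat z"] assms(2)
    by (simp add: disj_commute)
  then show ?thesis
    by (simp add: quadS_def quad_def disj_commute)
qed

text \<open>\<open>quadS\<close> is symmetric under exchange of the two columns, so its sum over all
  pairs survives a permutation of the columns. \<open>quadQ\<close> depends on their order, which is
  why pairs of rows are converted from the bottom up.\<close>

lemma gap_sum_col_map_below:
  assumes S: "S \<in> ordering_systems" and \<tau>: "admissible \<tau>" and \<pi>: "bij_betw \<pi> (level h) (level h)"
    and r': "1 \<le> r'" "r' < r" "r < h"
  shows "gap_sum (quadS S) (\<tau> \<circ> col_map h r \<pi>) h r' = gap_sum (quadS S) \<tau> h r'"
proof -
  let ?f = "\<lambda>j k. quadS S (\<tau> (r' + 1, j)) (\<tau> (r' + 1, k)) (\<tau> (r', j)) (\<tau> (r', k))"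
  let ?L = "sorted_list_of_set (level h)"
  have "gap_sum (quadS S) (\<tau> \<circ> col_map h r \<pi>) h r' = psum (\<lambda>j k. ?f (\<pi> j) (\<pi> k)) ?L"
    unfolding gap_sum_def using r' by (intro psum_cong) (auto simp: col_map_def)
  also have "\<dots> = psum ?f (map \<pi> ?L)"
    by (simp add: psum_map)
  also have "\<dots> = psum ?f ?L"
  proof (rule psum_perm)
    show d: "distinct (map \<pi> ?L)"
      using \<pi> by (simp add: distinct_map bij_betw_def)
    have "set (map \<pi> ?L) = set ?L"
      using \<pi> by (simp add: bij_betw_def)
    then show "mset (map \<pi> ?L) = mset ?L"
      using set_eq_iff_mset_eq_distinct[OF d distinct_sorted_list_of_set] by blast
    fix j k assume "j \<in> set (map \<pi> ?L)" "k \<in> set (map \<pi> ?L)" "j \<noteq> k"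
    then have "j \<in> level h" "k \<in> level h" "j \<noteq> k"
      using bij_betwE[OF \<pi>] by auto
    then show "?f j k = ?f k j"
      using admissible_row_neq[OF \<tau>, of j h k h "r' + 1"] r' by (intro quadS_commute[OF S]) auto
  qed
  finally show ?thesis
    by (simp add: gap_sum_def)
qed

section \<open>Mixed statistics, converted one pair of rows at a time\<close>

definition hybrid :: "ordering4 set \<Rightarrow> (nat \<times> nat) set \<Rightarrow> filling \<Rightarrow> int" where
  "hybrid S T \<tau> = (\<Sum>h\<in>set lam. \<Sum>r\<in>{1..<h}.
     gap_sum (if (h, r) \<in> T then quadS S else quadQ) \<tau> h r)"

lemma hybrid_cong:
  assumes "\<And>h r. h \<in> set lam \<Longrightarrow> 1 \<le> r \<Longrightarrow> r < h \<Longrightarrow> (h, r) \<in> T \<longleftrightarrow> (h, r) \<in> T'"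
  shows "hybrid S T = hybrid S T'"
  unfolding hybrid_def using assms by (intro ext sum.cong) auto

lemma row_class_eq: "row_class lam \<sigma> = {\<tau>. admissible \<tau> \<and> row_equivalent lam \<sigma> \<tau>}"
  by (auto simp: row_class_def admissible_def)

text \<open>Finiteness will turn an injective self-map of the class into a bijection.\<close>

lemma finite_row_class: "finite (row_class lam \<sigma>)"
proof (rule finite_subset)
  show "row_class lam \<sigma> \<subseteq> dg lam \<rightarrow>\<^sub>E \<sigma> ` dg lam"
  proof
    fix \<tau> assume \<tau>: "\<tau> \<in> row_class lam \<sigma>"
    then have ext: "\<tau> \<in> dg lam \<rightarrow>\<^sub>E {0<..}" and eq: "\<And>i. row_content lam \<sigma> i = row_content lam \<tau> i"
      by (auto simp: row_class_def positive_fillings_def row_equivalent_def)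
    have "\<tau> u \<in> \<sigma> ` dg lam" if "u \<in> dg lam" for u
    proof -
      have "\<tau> u \<in># row_content lam \<tau> (fst u)"
        using that finite_dg by (simp add: row_content_def)
      then have "\<tau> u \<in># row_content lam \<sigma> (fst u)"
        using eq by simp
      then show ?thesis
        using finite_dg by (auto simp: row_content_def)
    qed
    then show "\<tau> \<in> dg lam \<rightarrow>\<^sub>E \<sigma> ` dg lam"
      using ext by (auto simp: PiE_iff)
  qed
qed (simp add: finite_PiE finite_dg)

definition class_equidist :: "filling \<Rightarrow> (filling \<Rightarrow> int) \<Rightarrow> (filling \<Rightarrow> int) \<Rightarrow> bool" where
  "class_equidist \<sigma> s t \<longleftrightarrow> (\<exists>\<phi>. bij_betw \<phi> (row_class lam \<sigma>) (row_class lam \<sigma>) \<and>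
     (\<forall>\<tau>\<in>row_class lam \<sigma>. similar \<tau> (\<phi> \<tau>) \<and> t (\<phi> \<tau>) = s \<tau>))"

lemma class_equidist_refl: "class_equidist \<sigma> s s"
  unfolding class_equidist_def by (intro exI[of _ id]) (simp add: similar_refl)

lemma class_equidist_trans:
  assumes "class_equidist \<sigma> s t" "class_equidist \<sigma> t r"
  shows "class_equidist \<sigma> s r"
proof -
  let ?X = "row_class lam \<sigma>"
  obtain \<phi> \<psi> where \<phi>: "bij_betw \<phi> ?X ?X" "\<And>\<tau>. \<tau> \<in> ?X \<Longrightarrow> similar \<tau> (\<phi> \<tau>) \<and> t (\<phi> \<tau>) = s \<tau>"
    and \<psi>: "bij_betw \<psi> ?X ?X" "\<And>\<tau>. \<tau> \<in> ?X \<Longrightarrow> similar \<tau> (\<psi> \<tau>) \<and> r (\<psi> \<tau>) = t \<tau>"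
    using assms unfolding class_equidist_def by blast
  have "similar \<tau> ((\<psi> \<circ> \<phi>) \<tau>) \<and> r ((\<psi> \<circ> \<phi>) \<tau>) = s \<tau>" if "\<tau> \<in> ?X" for \<tau>
  proof -
    have "\<phi> \<tau> \<in> ?X"
      using \<phi>(1) that bij_betwE by blast
    then show ?thesis
      using \<phi>(2)[OF that] \<psi>(2)[of "\<phi> \<tau>"] similar_trans by auto
  qed
  then show ?thesis
    unfolding class_equidist_def using bij_betw_trans[OF \<phi>(1) \<psi>(1)] by blast
qed

text \<open>The bijection for a pair of rows depends only on the upper row and on the set of entries
  of the lower one. Both survive, so the induced map on fillings is injective. By
  \<open>below\<close>, all pairs of rows under \<open>r\<close> already carry the symmetric
  statistic, which is insensitive to the columns being moved.\<close>

lemma class_equidist_gap: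
  assumes S: "S \<in> ordering_systems" and r: "1 \<le> r" "r < h"
    and below: "\<And>r'. 1 \<le> r' \<Longrightarrow> r' < r \<Longrightarrow> (h, r') \<in> T" and new: "(h, r) \<notin> T"
  shows "class_equidist \<sigma> (hybrid S T) (hybrid S (insert (h, r) T))"
proof -
  let ?J = "level h" and ?L = "sorted_list_of_set (level h)" and ?X = "row_class lam \<sigma>"
  let ?g = "\<lambda>z w u v. int (Q_sys S (enat z) (enat w) (enat u) (enat v))"
  define M where "M a B = row_pair.lower_rows ?J a B" for a B
  define SQ where "SQ a u = psum (\<lambda>j k. quadQ (a j) (a k) (u j) (u k)) ?L" for a u :: "nat \<Rightarrow> nat"
  define SS where "SS a u = psum (\<lambda>j k. quadS S (a j) (a k) (u j) (u k)) ?L" for a u :: "nat \<Rightarrow> nat"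
  define D where "D a u = (\<Sum>j\<in>?J. of_bool (u j < a j) :: int)" for a u :: "nat \<Rightarrow> nat"
  define ok where "ok a B \<beta> \<longleftrightarrow> bij_betw \<beta> (M a B) (M a B) \<and>
    (\<forall>u\<in>M a B. D a (\<beta> u) = D a u \<and> SS a (\<beta> u) = SQ a u)" for a B \<beta>
  have "\<exists>\<beta>. ok a B \<beta>" if "inj_on a ?J" for a B
  proof -
    interpret row_pair ?J a B
      using that by unfold_locales auto
    show ?thesis
      using equidist_quad[OF decomposable_Q_sys[OF S], of ?L]
      by (auto simp: equidist_def ok_def M_def D_def SS_def SQ_def quadS_def descents_def)
  qed
  \<comment> \<open>The implication makes the statement total in \<open>a\<close> and
    \<open>B\<close>, so that a single choice function serves all fillings.\<close>
  then have "\<exists>\<beta>. inj_on a ?J \<longrightarrow> ok a B \<beta>" for a B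
    by blast
  then obtain \<beta> where \<beta>: "\<And>a B. inj_on a ?J \<Longrightarrow> ok a B (\<beta> a B)"
    by metis
  have M_iff: "u \<in> M a B \<longleftrightarrow> u \<in> ?J \<rightarrow>\<^sub>E B \<and> bij_betw u ?J B \<and> (\<forall>j\<in>?J. a j \<in> B \<longrightarrow> u j = a j)"
    if "inj_on a ?J" for u a B
  proof -
    interpret row_pair ?J a B
      using that by unfold_locales auto
    show ?thesis
      by (simp add: M_def lower_rows_def)
  qed
  define a where "a \<tau> = restrict (\<lambda>j. \<tau> (r + 1, j)) ?J" for \<tau> :: filling
  \<comment> \<open>Restricted to \<open>?J\<close>, since the elements of \<open>lower_rows\<close>
    are extensional.\<close>
  define u where "u \<tau> = restrict (\<lambda>j. \<tau> (r, j)) ?J" for \<tau> :: filling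
  define B where "B \<tau> = (\<lambda>j. \<tau> (r, j)) ` ?J" for \<tau> :: filling
  define u' where "u' \<tau> = \<beta> (a \<tau>) (B \<tau>) (u \<tau>)" for \<tau>
  \<comment> \<open>The permutation that realises the new lower row:
    \<open>u \<tau> \<circ> \<pi> \<tau>\<close> equals \<open>u' \<tau>\<close> on
    \<open>?J\<close>, and the entries below can follow it.\<close>
  define \<pi> where "\<pi> \<tau> = inv_into ?J (u \<tau>) \<circ> u' \<tau>" for \<tau>
  define \<phi> where "\<phi> \<tau> = \<tau> \<circ> col_map h r (\<pi> \<tau>)" for \<tau> :: filling
  have inj_a: "inj_on (a \<tau>) ?J" if "admissible \<tau>" for \<tau>
    using admissible_inj[OF that, of "r + 1" h] r by (simp add: a_def inj_on_def)
  have u_M: "u \<tau> \<in> M (a \<tau>) (B \<tau>)" if \<tau>: "admissible \<tau>" for \<tau>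
    unfolding M_iff[OF inj_a[OF \<tau>]]
  proof (intro conjI ballI impI)
    show "bij_betw (u \<tau>) ?J (B \<tau>)"
      using admissible_inj[OF \<tau>, of r h] r by (auto simp: u_def B_def bij_betw_def inj_on_def)
    show "u \<tau> j = a \<tau> j" if j: "j \<in> ?J" "a \<tau> j \<in> B \<tau>" for j
    proof -
      obtain k where k: "k \<in> ?J" "\<tau> (r + 1, j) = \<tau> (r, k)"
        using j by (auto simp: a_def B_def)
      then have "j = k"
        using admissible_diag_neq[OF \<tau>, of j h k h r] j(1) r by auto
      then show ?thesis
        using j(1) k by (simp add: a_def u_def)
    qed
  qed (auto simp: u_def B_def)
  have u'_M: "u' \<tau> \<in> M (a \<tau>) (B \<tau>)" and D_u': "D (a \<tau>) (u' \<tau>) = D (a \<tau>) (u \<tau>)"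
    and SS_u': "SS (a \<tau>) (u' \<tau>) = SQ (a \<tau>) (u \<tau>)" if "admissible \<tau>" for \<tau>
    using \<beta>[OF inj_a[OF that], of "B \<tau>"] u_M[OF that] bij_betwE unfolding ok_def u'_def by blast+
  have u_bij: "bij_betw (u \<tau>) ?J (B \<tau>)" and u'_bij: "bij_betw (u' \<tau>) ?J (B \<tau>)" if "admissible \<tau>" for \<tau>
    using u_M[OF that] u'_M[OF that] M_iff[OF inj_a[OF that]] by auto
  have \<pi>_bij: "bij_betw (\<pi> \<tau>) ?J ?J" if "admissible \<tau>" for \<tau>
    unfolding \<pi>_def by (rule bij_betw_trans[OF u'_bij[OF that] bij_betw_inv_into[OF u_bij[OF that]]])
  have \<pi>_eq: "\<tau> (r, \<pi> \<tau> j) = u' \<tau> j" if "admissible \<tau>" "j \<in> ?J" for \<tau> j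
  proof -
    have "u' \<tau> j \<in> u \<tau> ` ?J"
      using u_bij[OF that(1)] u'_bij[OF that(1)] that(2) by (auto simp: bij_betw_def)
    then have "u \<tau> (\<pi> \<tau> j) = u' \<tau> j"
      by (simp add: \<pi>_def f_inv_into_f)
    moreover have "\<pi> \<tau> j \<in> ?J"
      using bij_betwE[OF \<pi>_bij[OF that(1)]] that(2) by blast
    ultimately show ?thesis
      by (simp add: u_def)
  qed
  have admissible_\<phi>: "admissible (\<phi> \<tau>)" if \<tau>: "admissible \<tau>" for \<tau>
    unfolding \<phi>_def
  proof (rule admissible_col_map[OF \<tau> \<pi>_bij[OF \<tau>] r(2)])
    fix j k assume jk: "j \<in> ?J" "k \<in> ?J" and "\<tau> (r + 1, j) = \<tau> (r, \<pi> \<tau> k)"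
    then have eq: "a \<tau> j = u' \<tau> k"
      using \<pi>_eq[OF \<tau>] by (simp add: a_def)
    then have "a \<tau> j \<in> B \<tau>"
      using bij_betwE[OF u'_bij[OF \<tau>]] jk by auto
    then have "u' \<tau> j = u' \<tau> k"
      using u'_M[OF \<tau>] M_iff[OF inj_a[OF \<tau>]] jk eq by auto
    then show "j = k"
      using u'_bij[OF \<tau>] jk by (auto simp: bij_betw_def inj_on_def)
  qed
  have a_\<phi>: "a (\<phi> \<tau>) = a \<tau>" for \<tau>
    by (auto simp: a_def \<phi>_def col_map_def)
  have \<phi>_row: "\<phi> \<tau> (r, j) = u' \<tau> j" if "admissible \<tau>" "j \<in> ?J" for \<tau> j
    using \<pi>_eq[OF that] that(2) r(1) by (simp add: \<phi>_def col_map_def)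
  have u_\<phi>: "u (\<phi> \<tau>) = u' \<tau>" if "admissible \<tau>" for \<tau>
  proof -
    have "u' \<tau> \<in> ?J \<rightarrow>\<^sub>E B \<tau>"
      using u'_M[OF that] M_iff[OF inj_a[OF that]] by blast
    then have "u' \<tau> = restrict (u' \<tau>) ?J"
      by (simp only: PiE_restrict)
    also have "\<dots> = u (\<phi> \<tau>)"
      unfolding u_def using \<phi>_row[OF that] by (intro restrict_ext) simp
    finally show ?thesis ..
  qed
  have B_eq: "B \<tau> = u \<tau> ` ?J" for \<tau>
    by (simp add: B_def u_def)
  have B_\<phi>: "B (\<phi> \<tau>) = B \<tau>" if "admissible \<tau>" for \<tau>
    using u'_bij[OF that] by (simp add: B_eq[of "\<phi> \<tau>"] u_\<phi>[OF that] bij_betw_def)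
  have D_eq: "row_descents \<tau> h r = D (a \<tau>) (u \<tau>)" for \<tau>
    unfolding row_descents_def D_def by (intro sum.cong) (auto simp: a_def u_def)
  have sim: "similar \<tau> (\<phi> \<tau>)" if "admissible \<tau>" for \<tau>
    unfolding \<phi>_def
    by (rule similar_col_map[OF \<pi>_bij[OF that]])
      (simp only: D_eq \<phi>_def[symmetric] a_\<phi> u_\<phi>[OF that] D_u'[OF that])
  have stat: "hybrid S (insert (h, r) T) (\<phi> \<tau>) = hybrid S T \<tau>" if \<tau>: "admissible \<tau>" for \<tau>
    unfolding hybrid_def
  proof (intro sum.cong refl)
    fix h' r' :: nat assume r': "r' \<in> {1..<h'}"
    consider "h' \<noteq> h \<or> r < r'" | "h' = h" "r' < r" | "h' = h" "r' = r"
      by linarith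
    then show "gap_sum (if (h', r') \<in> insert (h, r) T then quadS S else quadQ) (\<phi> \<tau>) h' r' =
        gap_sum (if (h', r') \<in> T then quadS S else quadQ) \<tau> h' r'"
    proof cases
      case 1
      then have "(h', r') \<in> insert (h, r) T \<longleftrightarrow> (h', r') \<in> T"
        by auto
      then show ?thesis
        unfolding \<phi>_def using gap_sum_col_map_other[OF 1] by simp
    next
      case 2
      then have "(h', r') \<in> T"
        using below r' by auto
      then show ?thesis
        unfolding \<phi>_def
        using gap_sum_col_map_below[OF S \<tau> \<pi>_bij[OF \<tau>], of r' r] r r' 2 by simp
    next
      case 3
      have "gap_sum (quadS S) (\<phi> \<tau>) h r = SS (a (\<phi> \<tau>)) (u (\<phi> \<tau>))"
        unfolding gap_sum_def SS_def by (intro psum_cong) (auto simp: a_def u_def)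
      also have "\<dots> = SQ (a \<tau>) (u \<tau>)"
        using SS_u'[OF \<tau>] by (simp add: a_\<phi> u_\<phi>[OF \<tau>])
      also have "\<dots> = gap_sum quadQ \<tau> h r"
        unfolding gap_sum_def SQ_def by (intro psum_cong) (auto simp: a_def u_def)
      finally show ?thesis
        using 3 new by simp
    qed
  qed
  have X: "admissible \<tau>" if "\<tau> \<in> ?X" for \<tau>
    using that by (simp add: row_class_eq)
  have "\<phi> ` ?X \<subseteq> ?X"
  proof
    fix \<theta> assume "\<theta> \<in> \<phi> ` ?X"
    then obtain \<tau> where \<tau>: "\<theta> = \<phi> \<tau>" "admissible \<tau>" "row_equivalent lam \<sigma> \<tau>"
      by (auto simp: row_class_eq)
    then show "\<theta> \<in> ?X"
      using admissible_\<phi> row_equivalent_col_map[OF \<pi>_bij[OF \<tau>(2)] r(2), of \<tau>]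
      by (auto simp: row_class_eq row_equivalent_def \<phi>_def)
  qed
  moreover have "inj_on \<phi> ?X"
  proof (rule inj_onI)
    fix \<tau>1 \<tau>2 assume \<tau>12: "\<tau>1 \<in> ?X" "\<tau>2 \<in> ?X" and eq: "\<phi> \<tau>1 = \<phi> \<tau>2"
    note g = X[OF \<tau>12(1)] X[OF \<tau>12(2)]
    \<comment> \<open>The upper row and the set of lower entries are recovered from the image, then
      the old lower row because \<beta> is injective for these data, then the permutation, and
      finally the filling.\<close>
    have a: "a \<tau>1 = a \<tau>2"
      using a_\<phi>[of \<tau>1] a_\<phi>[of \<tau>2] eq by simp
    have B: "B \<tau>1 = B \<tau>2"
      using B_\<phi>[OF g(1)] B_\<phi>[OF g(2)] eq by simp
    have "\<beta> (a \<tau>2) (B \<tau>2) (u \<tau>1) = \<beta> (a \<tau>2) (B \<tau>2) (u \<tau>2)"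
      using u_\<phi>[OF g(1)] u_\<phi>[OF g(2)] eq a B by (simp add: u'_def)
    moreover have "inj_on (\<beta> (a \<tau>2) (B \<tau>2)) (M (a \<tau>2) (B \<tau>2))"
      using \<beta>[OF inj_a[OF g(2)], of "B \<tau>2"] by (simp add: ok_def bij_betw_def)
    ultimately have "u \<tau>1 = u \<tau>2"
      using u_M[OF g(1)] u_M[OF g(2)] a B by (auto dest: inj_onD)
    then have \<pi>: "\<pi> \<tau>1 = \<pi> \<tau>2"
      using a B by (simp add: \<pi>_def u'_def)
    show "\<tau>1 = \<tau>2"
    proof
      fix x
      show "\<tau>1 x = \<tau>2 x"
      proof (cases "snd x \<in> ?J \<and> 1 \<le> fst x \<and> fst x \<le> r")
        case True
        then obtain j where "j \<in> ?J" "snd x = \<pi> \<tau>1 j"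
          using \<pi>_bij[OF g(1)] by (auto simp: bij_betw_def)
        then have "x = col_map h r (\<pi> \<tau>1) (fst x, j)"
          using True by (simp add: col_map_def prod_eq_iff)
        then show ?thesis
          using fun_cong[OF eq, of "(fst x, j)"] \<pi> by (simp add: \<phi>_def)
      next
        case False
        then have "col_map h r (\<pi> \<tau>1) x = x" "col_map h r (\<pi> \<tau>2) x = x"
          unfolding col_map_def by (rule if_not_P)+
        then show ?thesis
          using fun_cong[OF eq, of x] by (simp add: \<phi>_def)
      qed
    qed
  qed
  ultimately have "bij_betw \<phi> ?X ?X"
    using endo_inj_surj[OF finite_row_class] by (simp add: bij_betw_def)
  then show ?thesis
    unfolding class_equidist_def using sim stat X by blast
qed

lemma class_equidist_all:
  assumes S: "S \<in> ordering_systems"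
  shows "class_equidist \<sigma> (hybrid S {}) (hybrid S UNIV)"
proof -
  \<comment> \<open>Lexicographic order: all pairs of rows in rectangles of height less than
    \<open>n\<close>, then those of height \<open>n\<close> with lower row under
    \<open>r\<close>.\<close>
  define P where "P n r = {(h', r'). h' < n \<or> h' = n \<and> r' < r}" for n r :: nat
  have level: "class_equidist \<sigma> (hybrid S (P n 0)) (hybrid S (P n r))" if "r \<le> n" for n r
    using that
  proof (induction r)
    case (Suc r)
    have insert: "P n (Suc r) = insert (n, r) (P n r)"
      by (auto simp: P_def)
    have "class_equidist \<sigma> (hybrid S (P n r)) (hybrid S (P n (Suc r)))"
    proof (cases "r = 0")
      case True
      \<comment> \<open>Row 0 lies outside the diagram and the sum in \<open>hybrid\<close> starts
        at row 1.\<close>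
      then have "hybrid S (P n r) = hybrid S (P n (Suc r))"
        unfolding insert by (intro hybrid_cong) auto
      then show ?thesis
        using class_equidist_refl by simp
    next
      case False
      then show ?thesis
        unfolding insert using Suc.prems
        by (intro class_equidist_gap[OF S]) (auto simp: P_def)
    qed
    then show ?case
      using Suc class_equidist_trans by auto
  qed (rule class_equidist_refl)
  have "class_equidist \<sigma> (hybrid S {}) (hybrid S (P n 0))" for n
  proof (induction n)
    case 0
    have "P 0 0 = {}"
      by (simp add: P_def)
    then show ?case
      using class_equidist_refl by simp
  next
    case (Suc n)
    have "hybrid S (P n n) = hybrid S (P (Suc n) 0)"
      by (rule hybrid_cong) (auto simp: P_def)
    then show ?case
      using Suc level[of n n] class_equidist_trans by auto
  qed
  moreover have "hybrid S (P (Suc (Max (set lam))) 0) = hybrid S UNIV"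
    by (rule hybrid_cong) (auto simp: P_def less_Suc_eq_le)
  ultimately show ?thesis
    by metis
qed

end

section \<open>The bijection on the class and the statistics it preserves\<close>

theorem theorem1p6:
  fixes lam :: "nat list" and \<sigma> :: filling and S :: "ordering4 set"
  assumes "is_partition lam"
    and "\<sigma> \<in> positive_fillings lam"
    and "non_attacking lam \<sigma>"
    and "top_row_increasing lam \<sigma>"
    and "S \<in> ordering_systems"
  shows "\<exists>\<phi>. bij_betw \<phi> (row_class lam \<sigma>) (row_class lam \<sigma>) \<and>
           (\<forall>\<tau>\<in>row_class lam \<sigma>.
              (maj lam (\<phi> \<tau>), eta_circ S lam (\<phi> \<tau>)) = (maj lam \<tau>, quadcoinv_bar lam \<tau>) \<and>
              c_coeff lam \<tau> = c_coeff lam (\<phi> \<tau>))"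
proof -
  interpret diagram lam
    using assms(1) by unfold_locales
  let ?X = "row_class lam \<sigma>"
  obtain \<phi> where bij: "bij_betw \<phi> ?X ?X"
    and \<phi>: "\<And>\<tau>. \<tau> \<in> ?X \<Longrightarrow> similar \<tau> (\<phi> \<tau>) \<and> hybrid S UNIV (\<phi> \<tau>) = hybrid S {} \<tau>"
    using class_equidist_all[OF assms(5), of \<sigma>] unfolding class_equidist_def by blast
  have "(maj lam (\<phi> \<tau>), eta_circ S lam (\<phi> \<tau>)) = (maj lam \<tau>, quadcoinv_bar lam \<tau>) \<and>
      c_coeff lam \<tau> = c_coeff lam (\<phi> \<tau>)" if \<tau>: "\<tau> \<in> ?X" for \<tau>
  proof -
    have g: "admissible \<tau>" "admissible (\<phi> \<tau>)"
      using \<tau> bij_betwE[OF bij] by (auto simp: row_class_eq)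
    \<comment> \<open>The empty set of converted pairs of rows gives \<open>quadQ\<close>
      throughout, the full set gives \<open>quadS S\<close>.\<close>
    have "(\<Sum>p\<in>inner. at_box (\<phi> \<tau>) (quadS S) p) = (\<Sum>p\<in>inner. at_box \<tau> quadQ p)"
      using \<phi>[OF \<tau>] by (simp add: sum_inner hybrid_def)
    \<comment> \<open>Both sides contain the same number of top positions, and the triples between
      rectangles agree by similarity.\<close>
    then have "int (eta S lam (\<phi> \<tau>)) + int (alpha S lam (\<phi> \<tau>)) = int (quadcoinv lam \<tau>)"
      using eta_alpha_eq[OF g(2) assms(5)] quadcoinv_eq[OF g(1)]
        uneven_triples_similar[OF g] \<phi>[OF \<tau>] by simp
    then show ?thesis
      using maj_similar c_coeff_similar[OF g] \<phi>[OF \<tau>]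
      by (simp add: eta_circ_def quadcoinv_bar_def)
  qed
  then show ?thesis
    using bij by blast
qed

end
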